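(* Let $Q_n=\langle a,b\mid a^{2n}=b^4=1,\ b^2=a^n,\ ab=ba^{-1}\rangle$ for an integer $n>1$. (i) If $n=p^\alpha$ with $p$ prime and $\alpha\ge1$, then $\Gamma(Q_n)$ is Hamiltonian iff either $p=2$ (and $\alpha\ge1$), or $p=3$ and $\alpha=1$. (ii) If $n=pq$ with $p,q$ distinct primes and $p<q$, then $\Gamma(Q_n)$ is Hamiltonian iff either $p=2$ and $q\le7$, or $p=3$ and $q=5$.
   Context: For a group $G$, $\Gamma(G)$ is the simple graph whose vertices are the subgroups of $G$ other than $\{1\}$ and $G$, two distinct vertices $H,K$ being adjacent iff $HK=KH$. A graph is Hamiltonian if it has a cycle through all its vertices. *)

theory Defs
  imports
    "HOL-Algebra.Coset"
    "HOL-Computational_Algebra.Primes"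
    "Graph_Theory.Pair_Digraph"
begin

section \<open>Groups given by generators and relations\<close>

text \<open>
  A word is a list of letters; \<open>(x, True)\<close> stands for the generator \<open>x\<close> and
  \<open>(x, False)\<close> for its formal inverse. The generators are all elements of the type \<open>'x\<close>.
  A relation \<open>u = v\<close> is represented by the pair \<open>(u, v)\<close>.
\<close>

type_synonym 'x word = "('x \<times> bool) list"

inductive pres_eq :: "('x word \<times> 'x word) set \<Rightarrow> 'x word \<Rightarrow> 'x word \<Rightarrow> bool"
  for R :: "('x word \<times> 'x word) set"
where
  pres_refl: "pres_eq R u u"
| pres_sym: "pres_eq R u v \<Longrightarrow> pres_eq R v u"
| pres_trans: "pres_eq R u v \<Longrightarrow> pres_eq R v w \<Longrightarrow> pres_eq R u w"
| pres_append: "pres_eq R u u' \<Longrightarrow> pres_eq R v v' \<Longrightarrow> pres_eq R (u @ v) (u' @ v')"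
| pres_cancel: "pres_eq R [(x, e), (x, \<not> e)] []"
| pres_rel: "(u, v) \<in> R \<Longrightarrow> pres_eq R u v"

definition pres_class :: "('x word \<times> 'x word) set \<Rightarrow> 'x word \<Rightarrow> 'x word set" where
  "pres_class R u = {v. pres_eq R u v}"

definition presented_group :: "('x word \<times> 'x word) set \<Rightarrow> 'x word set monoid" where
  "presented_group R =
    \<lparr> carrier = range (pres_class R),
      monoid.mult = (\<lambda>A B. \<Union>u\<in>A. \<Union>v\<in>B. pres_class R (u @ v)),
      one = pres_class R [] \<rparr>"

lemma pres_class_eq_iff: "pres_class R u = pres_class R v \<longleftrightarrow> pres_eq R u v"
  unfolding pres_class_def
  by (blast intro: pres_refl pres_sym pres_trans)

lemma presented_group_mult:
  "pres_class R u \<otimes>\<^bsub>presented_group R\<^esub> pres_class R v = pres_class R (u @ v)"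
  unfolding presented_group_def pres_class_def
  by (auto intro: pres_refl pres_trans pres_append)

lemma pres_inverse: "pres_eq R (rev (map (\<lambda>(x, e). (x, \<not> e)) u) @ u) []"
proof (induction u)
  case Nil
  show ?case by (simp add: pres_refl)
next
  case (Cons l u)
  obtain x e where l: "l = (x, e)" by (cases l)
  let ?i = "rev (map (\<lambda>(x, e). (x, \<not> e)) u)"
  have "pres_eq R [(x, \<not> e), (x, e)] []"
    using pres_cancel[of R x "\<not> e"] by simp
  then have "pres_eq R (?i @ [(x, \<not> e), (x, e)] @ u) (?i @ [] @ u)"
    by (intro pres_append pres_refl)
  then have "pres_eq R (?i @ [(x, \<not> e), (x, e)] @ u) []"
    using Cons.IH pres_trans by fastforce
  then show ?case by (simp add: l)
qed

lemma group_presented_group: "group (presented_group R)"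
proof (rule groupI)
  fix A assume "A \<in> carrier (presented_group R)"
  then obtain u where "A = pres_class R u"
    by (auto simp: presented_group_def)
  then show "\<exists>B\<in>carrier (presented_group R). B \<otimes>\<^bsub>presented_group R\<^esub> A = \<one>\<^bsub>presented_group R\<^esub>"
    using pres_inverse[of R u]
    by (intro bexI[of _ "pres_class R (rev (map (\<lambda>(x, e). (x, \<not> e)) u))"])
      (simp_all only: presented_group_mult, auto simp: presented_group_def pres_class_eq_iff)
next
  show "\<one>\<^bsub>presented_group R\<^esub> \<in> carrier (presented_group R)"
    by (simp add: presented_group_def)
next
  fix A assume "A \<in> carrier (presented_group R)"
  then obtain u where "A = pres_class R u"
    by (auto simp: presented_group_def)
  moreover have "\<one>\<^bsub>presented_group R\<^esub> = pres_class R []"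
    by (simp add: presented_group_def)
  ultimately show "\<one>\<^bsub>presented_group R\<^esub> \<otimes>\<^bsub>presented_group R\<^esub> A = A"
    by (simp add: presented_group_mult)
next
  fix A B C
  assume "A \<in> carrier (presented_group R)" "B \<in> carrier (presented_group R)"
    "C \<in> carrier (presented_group R)"
  then obtain u v w
    where "A = pres_class R u" "B = pres_class R v" "C = pres_class R w"
    by (auto simp: presented_group_def)
  then show "A \<otimes>\<^bsub>presented_group R\<^esub> B \<otimes>\<^bsub>presented_group R\<^esub> C
      = A \<otimes>\<^bsub>presented_group R\<^esub> (B \<otimes>\<^bsub>presented_group R\<^esub> C)"
    by (simp add: presented_group_mult)
next
  fix A B
  assume "A \<in> carrier (presented_group R)" "B \<in> carrier (presented_group R)"
  then obtain u v where "A = pres_class R u" "B = pres_class R v"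
    by (auto simp: presented_group_def)
  then show "A \<otimes>\<^bsub>presented_group R\<^esub> B \<in> carrier (presented_group R)"
    by (simp only: presented_group_mult) (simp add: presented_group_def)
qed

section \<open>The groups \<open>Q\<^sub>n\<close>\<close>

datatype Q_gen = Gen_a | Gen_b

abbreviation Q_a :: "Q_gen word" where "Q_a \<equiv> [(Gen_a, True)]"
abbreviation Q_a_inv :: "Q_gen word" where "Q_a_inv \<equiv> [(Gen_a, False)]"
abbreviation Q_b :: "Q_gen word" where "Q_b \<equiv> [(Gen_b, True)]"

definition word_pow :: "'x word \<Rightarrow> nat \<Rightarrow> 'x word" where
  "word_pow w k = concat (replicate k w)"

definition Q_relations :: "nat \<Rightarrow> (Q_gen word \<times> Q_gen word) set" where
  "Q_relations n =
    { (word_pow Q_a (2 * n), []),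
      (word_pow Q_b 4, []),
      (word_pow Q_b 2, word_pow Q_a n),
      (Q_a @ Q_b, Q_b @ Q_a_inv) }"

definition Q_group :: "nat \<Rightarrow> Q_gen word set monoid" where
  "Q_group n = presented_group (Q_relations n)"

section \<open>The permutability graph of subgroups\<close>

text \<open>
  Simple graphs are symmetric loop-free digraphs: an edge \<open>{H, K}\<close> is
  the pair of arcs \<open>(H, K)\<close>, \<open>(K, H)\<close>.
\<close>

definition subgroup_graph :: "('a, 'b) monoid_scheme \<Rightarrow> 'a set pair_pre_digraph" where
  "subgroup_graph G =
    (let V = {H. subgroup H G \<and> H \<noteq> {\<one>\<^bsub>G\<^esub>} \<and> H \<noteq> carrier G} in
      \<lparr> pverts = V,
        parcs = {(H, K). H \<in> V \<and> K \<in> V \<and> H \<noteq> K \<and> H <#>\<^bsub>G\<^esub> K = K <#>\<^bsub>G\<^esub> H} \<rparr>)"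

lemma subgroup_graph_pair_bidirected: "pair_bidirected_digraph (subgroup_graph G)"
  by unfold_locales (auto simp: subgroup_graph_def Let_def symmetric_def intro!: symI)

text \<open>
  The length bound is needed because \<open>pre_digraph.cycle\<close> also accepts the closed walk
  of length 2 that runs along an edge and back, which is not a cycle of the simple graph.
\<close>

definition hamiltonian :: "'a pair_pre_digraph \<Rightarrow> bool" where
  "hamiltonian G \<longleftrightarrow>
    (\<exists>p. pre_digraph.cycle (with_proj G) p \<and> length p \<ge> 3 \<and> fst ` set p = pverts G)"

end

theory Submission
  imports Defs "HOL-Number_Theory.Cong"
begin

text \<open>
  The nontrivial proper subgroups of \<open>Q\<^sub>n\<close> are the cyclic groups \<open>\<langle>a\<^sup>d\<rangle>\<close>, which are normal and
  hence adjacent to every vertex, and the groups \<open>\<langle>a\<^sup>d, a\<^sup>i b\<rangle>\<close> with \<open>d\<close> a divisor of \<open>n\<close> and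
  \<open>i\<close> taken modulo \<open>d\<close>; two of the latter permute iff \<open>gcd d e\<close> divides \<open>2 (i - j)\<close>.
  Removing \<open>k\<close> vertices from a Hamiltonian graph leaves at most \<open>k\<close> components; for odd \<open>n\<close> the \<open>n\<close>
  groups \<open>\<langle>a\<^sup>n, a\<^sup>i b\<rangle>\<close> are independent, which leaves only \<open>n = 3\<close>
  and \<open>n = 15\<close> among the odd \<open>n\<close> considered.
  Conversely, the universal vertices link a cover of the remaining vertices by few paths to a cycle.
\<close>

section \<open>Hamiltonian cycles of digraphs of pairs\<close>

text \<open>The negative cases are a count, and some positive cases meet it exactly. For n = p^m
  odd, removing everything but the \<open>(n, i)\<close> removes 2m + 1 cyclic subgroups and p + ...
  + p^(m-1) dicyclic ones, fewer than p^m in total except for 3^1. For odd n = pq it removes 7 + p +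
  q vertices, fewer than pq iff (p - 1)(q - 1) > 8, which fails only for 3 and 5. In both exceptions
  equality holds, so a path cover there has no slack. For n = 2q the factor 2 in the permutability
  condition makes \<open>(2q, i)\<close> and \<open>(2q, i + q)\<close> adjacent, so larger
  components take the place of isolated vertices: q of them against 5 + 2 removed vertices, with
  equality at q = 7. Components are handled through a colouring that is constant along the remaining
  arcs, so connectedness never has to be defined. A separate obstacle is the presentation: relations
  only bound the group from above. That the a^k and a^k b with k modulo 2n are distinct comes from
  letting words act on normal forms.\<close>

lemma pcas_closed:
  assumes "pcas u p v" "u \<in> S" "\<And>x y. (x, y) \<in> set p \<Longrightarrow> x \<in> S \<Longrightarrow> y \<in> S"
  shows "fst ` set p \<subseteq> S \<and> v \<in> S"
  using assms
proof (induction p arbitrary: u)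
  case (Cons e p)
  then show ?case by (cases e) auto
qed simp

lemma pcas_append: "pcas u (p @ q) w \<longleftrightarrow> (\<exists>v. pcas u p v \<and> pcas v q w)"
  by (induction p arbitrary: u) auto

text \<open>Following the walk from \<open>x\<close> stays in \<open>S\<close> up to its end
  \<open>u\<close>. Since \<open>u\<close> is also its start, the stretch before \<open>x\<close>
  stays in \<open>S\<close> too.\<close>

lemma pcas_closed_walk:
  assumes "pcas u p u" "(x, y) \<in> set p" "x \<in> S"
    and closed: "\<And>x y. (x, y) \<in> set p \<Longrightarrow> x \<in> S \<Longrightarrow> y \<in> S"
  shows "fst ` set p \<subseteq> S"
proof -
  obtain p1 p2 where p: "p = p1 @ (x, y) # p2"
    using assms(2) by (meson split_list)
  with assms(1) have "pcas u p1 x" "pcas x ((x, y) # p2) u"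
    by (auto simp: pcas_append)
  moreover from pcas_closed[OF this(2) assms(3)] closed p
  have "fst ` set ((x, y) # p2) \<subseteq> S" "u \<in> S" by auto
  moreover from pcas_closed[OF calculation(1) this(2)] closed p have "fst ` set p1 \<subseteq> S" by auto
  ultimately show ?thesis by (auto simp: p)
qed

lemma pawalk_verts_tl:
  "pcas u p v \<Longrightarrow> tl (pawalk_verts u p) = map snd p"
proof (induction p arbitrary: u)
  case (Cons e p)
  then show ?case by (cases p; cases e) auto
qed simp

text \<open>\<open>cycle\<close> asks for distinctness of the visited vertices without the first.
  Along a closed walk these are the heads of the arcs, so the condition says that each vertex is
  entered at most once.\<close>

lemma hamiltonian_iff_walk:
  "hamiltonian G \<longleftrightarrow> (\<exists>u p. u \<in> pverts G \<and> set p \<subseteq> parcs G \<and> pcas u p u \<and> distinct (map snd p) \<and>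
     length p \<ge> 3 \<and> fst ` set p = pverts G)"
  unfolding hamiltonian_def pre_digraph.cycle_def pre_digraph.awalk_def cas_with_proj_eq
    awalk_verts_with_proj_eq with_proj_simps
proof safe
  fix u p
  assume "pcas u p u" "distinct (tl (pawalk_verts u p))"
    "u \<in> pverts G" "set p \<subseteq> parcs G" "3 \<le> length p" "fst ` set p = pverts G"
  then show "\<exists>u p. u \<in> pverts G \<and> set p \<subseteq> parcs G \<and> pcas u p u \<and> distinct (map snd p) \<and>
     3 \<le> length p \<and> fst ` set p = pverts G"
    using pawalk_verts_tl[of u p u] by (intro exI[of _ u] exI[of _ p]) simp
next
  fix u p
  assume "u \<in> pverts G" "set p \<subseteq> parcs G" "pcas u p u" "distinct (map snd p)"
    "3 \<le> length p" "fst ` set p = pverts G"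
  then show "\<exists>p. (\<exists>u. (u \<in> pverts G \<and> set p \<subseteq> parcs G \<and> pcas u p u) \<and>
      distinct (tl (pawalk_verts u p)) \<and> p \<noteq> []) \<and> 3 \<le> length p \<and> fst ` set p = pverts G"
    using pawalk_verts_tl[of u p u] by (intro exI[of _ u] exI[of _ p] conjI) auto
qed

text \<open>Traversing the cycle, each colour class is left through an arc ending in \<open>U\<close>, and different
  classes are left towards different vertices of \<open>U\<close>.\<close>

lemma hamiltonian_colours_le:
  assumes ham: "hamiltonian G" and U: "U \<subseteq> pverts G" "finite U" "U \<noteq> {}"
    and colour: "\<And>x y. (x, y) \<in> parcs G \<Longrightarrow> x \<notin> U \<Longrightarrow> y \<notin> U \<Longrightarrow> c x = c y"
    and verts: "\<And>x y. (x, y) \<in> parcs G \<Longrightarrow> y \<in> pverts G"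
  shows "card (c ` (pverts G - U)) \<le> card U"
proof -
  from ham obtain u p where p: "set p \<subseteq> parcs G" "pcas u p u" "distinct (map snd p)"
      "fst ` set p = pverts G"
    unfolding hamiltonian_iff_walk by blast
  have "\<exists>x y. (x, y) \<in> set p \<and> x \<in> pverts G - U \<and> c x = k \<and> y \<in> U"
    if "k \<in> c ` (pverts G - U)" for k
  proof (rule ccontr)
    assume none: "\<not> ?thesis"
    define S where "S = {x \<in> pverts G - U. c x = k}"
    from that obtain x where x: "x \<in> S" unfolding S_def by auto
    then have "x \<in> fst ` set p" using p(4) by (auto simp: S_def)
    then obtain y where "(x, y) \<in> set p" by force
    \<comment> \<open>Without an arc from the class into \<open>U\<close>, each successor of a
      member of \<open>S\<close> is outside \<open>U\<close> and inherits the colour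
      \<open>k\<close>. The whole cycle would then lie in \<open>S\<close> and miss the nonempty set
      \<open>U\<close>.\<close>
    then have "fst ` set p \<subseteq> S"
    proof (rule pcas_closed_walk[OF p(2) _ x])
      fix x y assume "(x, y) \<in> set p" "x \<in> S"
      then show "y \<in> S"
        using none colour[of x y] verts[of x y] p(1) by (fastforce simp: S_def)
    qed
    then show False using p(4) U by (auto simp: S_def)
  qed
  then obtain f g where fg: "\<And>k. k \<in> c ` (pverts G - U) \<Longrightarrow>
      (f k, g k) \<in> set p \<and> c (f k) = k \<and> g k \<in> U"
    by metis
  \<comment> \<open>A vertex of \<open>U\<close> is entered by only one arc, whose tail determines
    the colour.\<close>
  have "inj_on g (c ` (pverts G - U))"
  proof (rule inj_onI)
    fix k l assume kl: "k \<in> c ` (pverts G - U)" "l \<in> c ` (pverts G - U)" "g k = g l"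
    have "inj_on snd (set p)" using p(3) by (simp add: distinct_map)
    moreover have "(f k, g k) \<in> set p" "(f l, g k) \<in> set p"
      using fg[OF kl(1)] fg[OF kl(2)] unfolding kl(3) by blast+
    ultimately have "f k = f l" unfolding inj_on_def by fastforce
    moreover have "c (f k) = k" "c (f l) = l" using fg[OF kl(1)] fg[OF kl(2)] by blast+
    ultimately show "k = l" by metis
  qed
  then show ?thesis
    using fg U by (intro card_inj_on_le) auto
qed

section \<open>Cycles from vertex lists and from path covers\<close>

lemma pcas_vertex_list:
  "xs \<noteq> [] \<Longrightarrow> pcas (hd xs) (zip xs (tl xs @ [v])) v"
proof (induction xs)
  case (Cons x xs)
  then show ?case by (cases xs) auto
qed simp

lemma set_zip_vertex_list:
  assumes "successively P xs" "xs \<noteq> []" "P (last xs) v"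
  shows "\<forall>(x, y) \<in> set (zip xs (tl xs @ [v])). P x y"
  using assms
proof (induction xs)
  case (Cons x xs)
  then show ?case by (cases xs) auto
qed simp

lemma hamiltonian_vertex_list:
  assumes "distinct xs" "length xs \<ge> 3" "set xs = pverts G"
    and "successively (\<lambda>x y. (x, y) \<in> parcs G) xs" "(last xs, hd xs) \<in> parcs G"
  shows "hamiltonian G"
  unfolding hamiltonian_iff_walk
proof (intro exI conjI)
  \<comment> \<open>Pairing the list with its cyclic shift yields the arcs, including the closing
    one from \<open>last xs\<close> to \<open>hd xs\<close>.\<close>
  let ?p = "zip xs (tl xs @ [hd xs])"
  have ne: "xs \<noteq> []" using assms(2) by auto
  then have len: "length (tl xs @ [hd xs]) = length xs" by simp
  show "pcas (hd xs) ?p (hd xs)" using pcas_vertex_list[OF ne] .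
  show "set ?p \<subseteq> parcs G"
    using set_zip_vertex_list[OF assms(4) ne, of "hd xs"] assms(5) by auto
  have "distinct (hd xs # tl xs)" using assms(1) ne by simp
  then show "distinct (map snd ?p)" using len by (simp add: map_snd_zip del: list.collapse)
  show "length ?p \<ge> 3" using assms(2) len by simp
  have "map fst ?p = xs" using len by (simp add: map_fst_zip)
  then show "fst ` set ?p = pverts G" using assms(3) by (metis list.set_map)
  show "hd xs \<in> pverts G" using assms(3) ne by force
qed

text \<open>Every path is preceded by its own linking vertex. Paths may be empty, in which case two
  linking vertices become neighbours; this is why \<open>x\<close> also ranges over
  \<open>set us\<close>.\<close>

lemma successively_interleave:
  assumes "length us = length ps" "\<forall>p \<in> set ps. successively P p"
    and "\<And>u x. u \<in> set us \<Longrightarrow> x \<in> set us \<union> \<Union> (set ` set ps) \<Longrightarrow> u \<noteq> x \<Longrightarrow> P u x \<and> P x u"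
    and "distinct us" "\<And>p. p \<in> set ps \<Longrightarrow> set us \<inter> set p = {}"
  shows "successively P (concat (map2 (#) us ps))"
  using assms
proof (induction us ps rule: list_induct2)
  case (Cons u us p ps)
  let ?C = "concat (map2 (#) us ps)"
  have IH: "successively P ?C"
    using Cons.prems by (intro Cons.IH) auto
  have up: "successively P (u # p)"
    using Cons.prems(1) Cons.prems(2)[of u "hd p"] Cons.prems(4)[of p]
    by (cases p) (auto simp: successively_Cons)
  have "P (last (u # p)) (hd ?C)" if "?C \<noteq> []"
  proof -
    from that obtain v where v: "v \<in> set us" "hd ?C = v"
      by (cases us; cases ps) auto
    have "last (u # p) \<in> insert u (set p)" by auto
    moreover have "last (u # p) \<noteq> v"
    proof (cases "p = []")
      case False
      then have "last p \<in> set p" by simp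
      moreover have "v \<notin> set p" using v(1) Cons.prems(4)[of p] by auto
      ultimately show ?thesis using False by auto
    qed (use v Cons.prems(3) in auto)
    ultimately show ?thesis
      using Cons.prems(2)[of v "last (u # p)"] v by auto
  qed
  with IH up have "successively P ((u # p) @ ?C)"
    unfolding successively_append_iff by blast
  then show ?case by simp
qed simp

lemma set_distinct_interleave:
  assumes "length us = length ps"
  shows "set (concat (map2 (#) us ps)) = set us \<union> set (concat ps)"
    and "distinct us \<Longrightarrow> distinct (concat ps) \<Longrightarrow> set us \<inter> set (concat ps) = {} \<Longrightarrow>
      distinct (concat (map2 (#) us ps))"
proof -
  show "set (concat (map2 (#) us ps)) = set us \<union> set (concat ps)"
    using assms by (induction us ps rule: list_induct2) auto
  show "distinct (concat (map2 (#) us ps))"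
    if "distinct us" "distinct (concat ps)" "set us \<inter> set (concat ps) = {}"
    using assms that
  proof (induction us ps rule: list_induct2)
    case (Cons u us p ps)
    have "distinct (concat (map2 (#) us ps))"
      using Cons.prems by (intro Cons.IH) auto
    moreover have "set (concat (map2 (#) us ps)) = set us \<union> set (concat ps)"
      using Cons.hyps by (induction us ps rule: list_induct2) auto
    then have "set (u # p) \<inter> set (concat (map2 (#) us ps)) = {}"
      using Cons.prems by (simp only:) auto
    moreover have "distinct (u # p)" using Cons.prems by auto
    ultimately show ?case
      using distinct_append[of "u # p" "concat (map2 (#) us ps)"] by simp
  qed simp
qed

lemma hamiltonian_path_cover:
  assumes verts: "pverts G = U \<union> set (concat ps)" and disj: "U \<inter> set (concat ps) = {}"
    and U: "finite U" "U \<noteq> {}" "length ps \<le> card U"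
    and dist: "distinct (concat ps)"
    and paths: "\<And>p. p \<in> set ps \<Longrightarrow> successively (\<lambda>x y. (x, y) \<in> parcs G) p"
    and univ: "\<And>u x. u \<in> U \<Longrightarrow> x \<in> pverts G \<Longrightarrow> u \<noteq> x \<Longrightarrow> (u, x) \<in> parcs G \<and> (x, u) \<in> parcs G"
    and large: "card (pverts G) \<ge> 3"
  shows "hamiltonian G"
proof -
  obtain us where us: "set us = U" "distinct us"
    using finite_distinct_list[OF U(1)] by blast
  \<comment> \<open>Padding with empty paths gives every universal vertex a path to precede, so
    surplus universal vertices are visited as well.\<close>
  define qs where "qs = ps @ replicate (card U - length ps) []"
  define xs where "xs = concat (map2 (#) us qs)"
  have len: "length us = length qs"
    using us U by (simp add: qs_def flip: distinct_card)
  have cqs: "concat qs = concat ps" by (simp add: qs_def)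
  have set_xs: "set xs = pverts G"
    using set_distinct_interleave(1)[OF len] by (simp only: xs_def cqs us verts)
  have dist_xs: "distinct xs"
    unfolding xs_def
    by (rule set_distinct_interleave(2)[OF len]) (use us dist disj in \<open>simp_all only: cqs\<close>)
  have len_xs: "length xs \<ge> 3"
    using large set_xs distinct_card[OF dist_xs] by simp
  have succ: "successively (\<lambda>x y. (x, y) \<in> parcs G) xs"
    unfolding xs_def
  proof (rule successively_interleave[OF len])
    show "\<forall>p\<in>set qs. successively (\<lambda>x y. (x, y) \<in> parcs G) p"
      using paths by (auto simp: qs_def set_replicate_conv_if)
    show "distinct us" by fact
    show "(u, x) \<in> parcs G \<and> (x, u) \<in> parcs G"
      if "u \<in> set us" "x \<in> set us \<union> \<Union> (set ` set qs)" "u \<noteq> x" for u x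
    proof -
      have "x \<in> pverts G" using that(2) unfolding verts us(1) cqs[symmetric] by auto
      then show ?thesis using univ that us by blast
    qed
    show "set us \<inter> set p = {}" if "p \<in> set qs" for p
      using that disj us cqs by (auto simp: qs_def)
  qed
  \<comment> \<open>The list starts with a universal vertex, so the closing arc exists as soon as
    the two ends differ.\<close>
  have hd: "hd xs \<in> U"
    using us U len by (cases us; cases qs) (auto simp: xs_def)
  have ne: "xs \<noteq> []" using len_xs by auto
  have "last xs \<noteq> hd xs"
  proof -
    from ne obtain y ys where xs: "xs = y # ys" by (cases xs) auto
    with len_xs have "ys \<noteq> []" by auto
    then have "last ys \<in> set ys" by simp
    then show ?thesis using dist_xs xs \<open>ys \<noteq> []\<close> by auto
  qed
  moreover have "last xs \<in> pverts G" using last_in_set[OF ne] unfolding set_xs .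
  ultimately have "(last xs, hd xs) \<in> parcs G" using univ[of "hd xs" "last xs"] hd by simp
  then show ?thesis using hamiltonian_vertex_list[OF dist_xs len_xs set_xs succ] by blast
qed

section \<open>Subgroups of dicyclic groups\<close>

text \<open>\<open>d\<close> stands for \<open>\<langle>a\<^sup>d\<rangle>\<close>, and \<open>(d, i)\<close> for \<open>\<langle>a\<^sup>d, a\<^sup>i b\<rangle>\<close>.\<close>

definition cyc_index :: "nat \<Rightarrow> nat set" where
  "cyc_index n = {d. d dvd 2 * n \<and> d \<noteq> 2 * n}"

text \<open>Here d = 1 is left out because it gives the whole group, while \<open>cyc_index\<close>
  leaves out 2n because it gives the trivial one.\<close>

definition dic_index :: "nat \<Rightarrow> (nat \<times> nat) set" where
  "dic_index n = {(d, i). d dvd n \<and> d \<noteq> 1 \<and> i < d}"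

text \<open>Mentions neither a group nor n, so that adjacency in explicit covers can be
  evaluated.\<close>

definition dic_adj :: "nat \<times> nat \<Rightarrow> nat \<times> nat \<Rightarrow> bool" where
  "dic_adj x y \<longleftrightarrow> x \<noteq> y \<and> int (gcd (fst x) (fst y)) dvd 2 * (int (snd x) - int (snd y))"

text \<open>The group of order \<open>4 n\<close> with elements \<open>a k = a\<^sup>k\<close> and \<open>c k = a\<^sup>k b\<close>, where \<open>k\<close> is
  taken modulo \<open>2 n\<close>.\<close>

locale dicyclic = group G for G (structure) +
  fixes n :: nat and a c :: "int \<Rightarrow> 'a"
  assumes n_pos: "n > 0"
    and carrier_eq: "carrier G = range a \<union> range c"
    and mult_aa: "a i \<otimes> a j = a (i + j)"
    and mult_ac: "a i \<otimes> c j = c (i + j)"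
    and mult_ca: "c i \<otimes> a j = c (i - j)"
    and mult_cc: "c i \<otimes> c j = a (i - j + int n)"
    and a_eq_iff: "a i = a j \<longleftrightarrow> [i = j] (mod 2 * int n)"
    and c_eq_iff: "c i = c j \<longleftrightarrow> [i = j] (mod 2 * int n)"
    and a_neq_c: "a i \<noteq> c j"
begin

lemma a_carrier [simp]: "a i \<in> carrier G" and c_carrier [simp]: "c i \<in> carrier G"
  by (auto simp: carrier_eq)

lemma c_neq_a: "c i \<noteq> a j"
  using a_neq_c by metis

lemma one_eq: "\<one> = a 0"
  using mult_aa[of 0 0] by (metis add_0 a_carrier l_cancel_one one_closed)

lemma inv_a: "inv (a i) = a (- i)"
  by (rule inv_equality) (auto simp: mult_aa one_eq)

lemma inv_c: "inv (c i) = c (i + int n)"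
  by (rule inv_equality) (auto simp: mult_cc one_eq a_eq_iff cong_iff_dvd_diff)

definition Cyc :: "nat \<Rightarrow> 'a set" where
  "Cyc d = a ` {k. int d dvd k}"

definition Dic :: "nat \<Rightarrow> int \<Rightarrow> 'a set" where
  "Dic d i = a ` {k. int d dvd k} \<union> c ` {k. int d dvd k - i}"

text \<open>Exponents are determined only modulo 2n. Because \<open>d\<close> divides 2n, tests for
  divisibility by \<open>d\<close> are well defined on group elements.\<close>

lemma dvd_cong_mod_2n:
  assumes "d dvd 2 * n" "[k = l] (mod 2 * int n)"
  shows "int d dvd k - m \<longleftrightarrow> int d dvd l - m"
proof -
  have "int d dvd 2 * int n" using assms(1) by (metis int_dvd_int_iff of_nat_mult of_nat_numeral)
  then have "int d dvd k - l" using assms(2) by (metis cong_iff_dvd_diff dvd_trans)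
  then show ?thesis by (metis diff_add_cancel dvd_add_right_iff diff_diff_eq2 add_diff_eq add.commute)
qed

lemma a_in_Cyc: "d dvd 2 * n \<Longrightarrow> a k \<in> Cyc d \<longleftrightarrow> int d dvd k"
  unfolding Cyc_def using dvd_cong_mod_2n[of d k _ 0] by (auto simp: a_eq_iff)

lemma c_notin_Cyc: "c k \<notin> Cyc d"
  unfolding Cyc_def using c_neq_a by auto

lemma a_in_Dic: "d dvd 2 * n \<Longrightarrow> a k \<in> Dic d i \<longleftrightarrow> int d dvd k"
  unfolding Dic_def using dvd_cong_mod_2n[of d k _ 0] by (auto simp: a_eq_iff a_neq_c)

lemma c_in_Dic: "d dvd 2 * n \<Longrightarrow> c k \<in> Dic d i \<longleftrightarrow> int d dvd k - i"
  unfolding Dic_def using dvd_cong_mod_2n[of d k _ i] by (auto simp: c_eq_iff c_neq_a)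

lemma Cyc_subset: "Cyc d \<subseteq> carrier G" and Dic_subset: "Dic d i \<subseteq> carrier G"
  by (auto simp: Cyc_def Dic_def)

lemma subgroup_Cyc: "subgroup (Cyc d) G"
proof (rule subgroupI)
  show "Cyc d \<noteq> {}" unfolding Cyc_def using dvd_0_right by blast
qed (auto simp: Cyc_def inv_a mult_aa intro!: imageI)

text \<open>Conjugation by \<open>a i\<close> fixes every \<open>a k\<close>, and conjugation by
  \<open>c i\<close> turns it into \<open>a (- k)\<close>.\<close>

lemma normal_Cyc: "Cyc d \<lhd> G"
  unfolding normal_inv_iff
proof (intro conjI ballI subgroup_Cyc)
  fix x h assume "x \<in> carrier G" "h \<in> Cyc d"
  then show "x \<otimes> h \<otimes> inv x \<in> Cyc d"
  proof (cases "x \<in> range c")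
    case True
    then obtain i k where "x = c i" "h = a k" "int d dvd k"
      using \<open>h \<in> Cyc d\<close> by (auto simp: Cyc_def)
    then show ?thesis
      by (auto simp: Cyc_def inv_c mult_cc mult_ca)
  qed (auto simp: Cyc_def carrier_eq inv_a mult_aa)
qed

text \<open>The square of any \<open>c k\<close> is \<open>a (int n)\<close>, which lies in
  \<open>Dic d i\<close> because \<open>d\<close> divides \<open>n\<close>.\<close>

lemma subgroup_Dic:
  assumes "d dvd n"
  shows "subgroup (Dic d i) G"
proof (rule subgroupI)
  have n: "int d dvd int n" using assms by simp
  show "Dic d i \<noteq> {}" unfolding Dic_def by (blast intro: dvd_0_right)
  show "inv x \<in> Dic d i" if "x \<in> Dic d i" for x
  proof -
    have "int d dvd (k - i) + int n" if "int d dvd k - i" for k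
      using that n by (rule dvd_add)
    then show ?thesis
      using that by (auto simp: Dic_def inv_a inv_c algebra_simps intro!: imageI)
  qed
  show "x \<otimes> y \<in> Dic d i" if "x \<in> Dic d i" "y \<in> Dic d i" for x y
  proof -
    have "int d dvd (u - i) - (v - i) + int n" if "int d dvd u - i" "int d dvd v - i" for u v
      using dvd_add[OF dvd_diff[OF that] n] .
    moreover have "int d dvd u + (v - i)" "int d dvd (v - i) - u"
      if "int d dvd u" "int d dvd v - i" for u v
      using that by simp_all
    ultimately show ?thesis
      using that
      by (auto simp: Dic_def mult_aa mult_ac mult_ca mult_cc algebra_simps intro!: imageI)
  qed
qed (use Dic_subset in blast)

text \<open>The least positive member divides all others, since a remainder modulo it is a smaller
  nonnegative member. The given \<open>m\<close> ensures that a positive member exists.\<close>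

lemma int_subgroup_multiples:
  assumes diff: "\<And>k l. P k \<Longrightarrow> P l \<Longrightarrow> P (k - l :: int)" and m: "P m" "m > 0"
  obtains d where "d > 0" "\<And>k. P k \<longleftrightarrow> int d dvd k"
proof -
  define d where "d = (LEAST k. k > 0 \<and> P (int k))"
  have d: "d > 0" "P (int d)" and least: "\<And>k. k > 0 \<Longrightarrow> P (int k) \<Longrightarrow> d \<le> k"
    using LeastI[of "\<lambda>k. k > 0 \<and> P (int k)" "nat m"] m
    by (auto simp: d_def intro: Least_le)
  have zero: "P 0" using diff[OF m(1) m(1)] by simp
  have neg: "P (- k)" if "P k" for k using diff[OF zero that] by simp
  have add: "P (k + l)" if "P k" "P l" for k l using diff[OF that(1) neg[OF that(2)]] by simp
  have nat_mult: "P (int d * int t)" for t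
    by (induction t) (use zero add d in \<open>auto simp: algebra_simps\<close>)
  have mult: "P (int d * t)" for t
    using nat_mult[of "nat \<bar>t\<bar>"] neg[of "int d * int (nat \<bar>t\<bar>)"] by (cases "t \<ge> 0") auto
  have "int d dvd k" if "P k" for k
  proof -
    have "P (k mod int d)"
      using diff[OF that mult[of "k div int d"]] by (simp add: minus_mult_div_eq_mod)
    moreover have "0 \<le> k mod int d" "k mod int d < int d" using d(1) by simp_all
    ultimately have "k mod int d = 0"
      using least[of "nat (k mod int d)"] by (cases "k mod int d = 0") auto
    then show ?thesis by (simp add: dvd_eq_mod_eq_0)
  qed
  moreover have "P k" if "int d dvd k" for k
    using that mult by (auto elim!: dvdE)
  ultimately show ?thesis using that[OF d(1)] by blast
qed

lemma elements_eqI: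
  assumes "A \<subseteq> carrier G" "B \<subseteq> carrier G"
    and "\<And>k. a k \<in> A \<longleftrightarrow> a k \<in> B" "\<And>k. c k \<in> A \<longleftrightarrow> c k \<in> B"
  shows "A = B"
proof -
  have "x \<in> A \<longleftrightarrow> x \<in> B" if "x \<in> carrier G" for x
    using that assms(3,4) unfolding carrier_eq by auto
  then show ?thesis using assms(1,2) by auto
qed

text \<open>The exponents of powers of a in \<open>H\<close> are the multiples of some
  \<open>d\<close>, which divides 2n as \<open>a (2 * int n)\<close> is the identity. If some
  \<open>c i\<close> is in \<open>H\<close>, its square forces \<open>d\<close> to divide
  \<open>n\<close>, and quotients of two such elements show that \<open>i\<close> is unique modulo
  \<open>d\<close>.\<close>

lemma subgroup_cases:
  assumes "subgroup H G"
  obtains d where "d dvd 2 * n" "H = Cyc d"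
  | d i where "d dvd n" "i < d" "H = Dic d (int i)"
proof -
  interpret H: subgroup H G by fact
  have a0: "a 0 \<in> H" using H.one_closed by (simp add: one_eq)
  have diff: "a (k - l) \<in> H" if "a k \<in> H" "a l \<in> H" for k l
    using H.m_closed[OF that(1) H.m_inv_closed[OF that(2)]] by (simp add: inv_a mult_aa)
  have "a (2 * int n) \<in> H"
    using a0 a_eq_iff[of "2 * int n" 0] by (simp add: cong_iff_dvd_diff)
  from int_subgroup_multiples[of "\<lambda>k. a k \<in> H", OF diff this] n_pos
  obtain d where d: "d > 0" "\<And>k. a k \<in> H \<longleftrightarrow> int d dvd k" by auto
  have "int d dvd int (2 * n)" using d(2) \<open>a (2 * int n) \<in> H\<close> by simp
  then have d2n: "d dvd 2 * n" by (simp only: int_dvd_int_iff)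
  show thesis
  proof (cases "\<exists>i. c i \<in> H")
    case False
    then have "H = Cyc d"
      using H.subset Cyc_subset by (intro elements_eqI) (simp_all add: d a_in_Cyc[OF d2n] c_notin_Cyc)
    then show thesis using that(1) d2n by blast
  next
    case True
    then obtain i where i: "c i \<in> H" by blast
    have "a (int n) \<in> H" using H.m_closed[OF i i] by (simp add: mult_cc)
    then have dn: "int d dvd int n" using d(2) by simp
    define j where "j = nat (i mod int d)"
    have j: "int j = i mod int d" using d(1) by (simp add: j_def)
    have ij: "int d dvd i - int j" unfolding j by (simp add: minus_mod_eq_mult_div)
    have "c k \<in> H \<longleftrightarrow> int d dvd k - int j" for k
    proof
      assume "c k \<in> H"
      then have "a (k - i + int n) \<in> H" using H.m_closed[of "c k" "c i"] i by (simp add: mult_cc)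
      then have "int d dvd k - i" using d(2) dn by (metis dvd_add_left_iff)
      then have "int d dvd (k - i) + (i - int j)" using ij by (rule dvd_add)
      then show "int d dvd k - int j" by simp
    next
      assume "int d dvd k - int j"
      then have "int d dvd (k - int j) - (i - int j)" using ij by (rule dvd_diff)
      then have "a (k - i) \<in> H" using d(2) by simp
      from H.m_closed[OF this i] show "c k \<in> H" by (simp add: mult_ac)
    qed
    then have "H = Dic d (int j)"
      using H.subset Dic_subset
      by (intro elements_eqI) (simp_all add: d a_in_Dic[OF d2n] c_in_Dic[OF d2n])
    moreover have "j < d" using d(1) unfolding j_def by (simp add: nat_less_iff)
    ultimately show thesis using that(2)[of d j] dn by (auto simp only: int_dvd_int_iff)
  qed
qed

lemma Cyc_eq_iff:
  assumes "d dvd 2 * n" "e dvd 2 * n"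
  shows "Cyc d = Cyc e \<longleftrightarrow> d = e"
proof
  assume "Cyc d = Cyc e"
  then have "int d dvd k \<longleftrightarrow> int e dvd k" for k using a_in_Cyc assms by metis
  then show "d = e" by (metis dvd_antisym dvd_refl int_dvd_int_iff)
qed simp

lemma Dic_eq_iff:
  assumes "d dvd n" "e dvd n" "i < d" "j < e"
  shows "Dic d (int i) = Dic e (int j) \<longleftrightarrow> d = e \<and> i = j"
proof
  assume eq: "Dic d (int i) = Dic e (int j)"
  have d: "d dvd 2 * n" "e dvd 2 * n" using assms by simp_all
  then have "int d dvd k \<longleftrightarrow> int e dvd k" for k using eq a_in_Dic by metis
  then have de: "d = e" by (metis dvd_antisym dvd_refl int_dvd_int_iff)
  have "int d dvd int i - int j"
    using eq c_in_Dic[OF d(1), of "int i" "int i"] c_in_Dic[OF d(2), of "int i" "int j"] de by simp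
  then have "[i = j] (mod d)" by (simp add: cong_iff_dvd_diff flip: cong_int_iff)
  then show "d = e \<and> i = j" using assms de by (simp add: cong_less_modulus_unique_nat)
qed simp

lemma Cyc_neq_Dic: "d dvd 2 * n \<Longrightarrow> e dvd n \<Longrightarrow> Cyc d \<noteq> Dic e i"
  using c_in_Dic[of e i i] c_notin_Cyc[of i d] by auto

lemma Cyc_trivial_iff: "d dvd 2 * n \<Longrightarrow> Cyc d = {\<one>} \<longleftrightarrow> d = 2 * n"
proof -
  have "Cyc (2 * n) = {\<one>}"
    unfolding Cyc_def one_eq by (auto simp: a_eq_iff cong_iff_dvd_diff image_iff)
  then show "d dvd 2 * n \<Longrightarrow> ?thesis" using Cyc_eq_iff[of d "2 * n"] by simp
qed

lemma Dic_not_trivial: "Dic d i \<noteq> {\<one>}"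
proof -
  have "c i \<in> Dic d i" unfolding Dic_def by auto
  then show ?thesis using c_neq_a by (auto simp: one_eq)
qed

lemma Cyc_neq_carrier: "Cyc d \<noteq> carrier G"
  using c_notin_Cyc[of 0 d] c_carrier[of 0] by metis

lemma Dic_carrier_iff:
  assumes "d dvd n"
  shows "Dic d i = carrier G \<longleftrightarrow> d = 1"
proof
  assume "Dic d i = carrier G"
  then have "a 1 \<in> Dic d i" by simp
  then show "d = 1" using a_in_Dic[of d 1 i] assms by auto
next
  assume "d = 1"
  then show "Dic d i = carrier G" by (auto simp: Dic_def carrier_eq)
qed

section \<open>Vertices and arcs of the graph in terms of indices\<close>

abbreviation Dic' :: "nat \<times> nat \<Rightarrow> 'a set" where
  "Dic' x \<equiv> Dic (fst x) (int (snd x))"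

lemma pverts_subgroup_graph: "pverts (subgroup_graph G) = Cyc ` cyc_index n \<union> Dic' ` dic_index n"
proof (intro equalityI subsetI)
  fix H assume "H \<in> pverts (subgroup_graph G)"
  then have H: "subgroup H G" "H \<noteq> {\<one>}" "H \<noteq> carrier G"
    by (auto simp: subgroup_graph_def Let_def)
  from H(1) show "H \<in> Cyc ` cyc_index n \<union> Dic' ` dic_index n"
  proof (cases rule: subgroup_cases)
    case (1 d)
    then show ?thesis using H Cyc_trivial_iff by (auto simp: cyc_index_def)
  next
    case (2 d i)
    then have "(d, i) \<in> dic_index n" using H Dic_carrier_iff[of d i] by (auto simp: dic_index_def)
    then show ?thesis using 2 by force
  qed
next
  fix H assume "H \<in> Cyc ` cyc_index n \<union> Dic' ` dic_index n"
  then show "H \<in> pverts (subgroup_graph G)"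
    using subgroup_Cyc subgroup_Dic Cyc_trivial_iff Dic_not_trivial Cyc_neq_carrier Dic_carrier_iff
    by (auto simp: subgroup_graph_def Let_def cyc_index_def dic_index_def)
qed

lemma inj_Cyc: "inj_on Cyc (cyc_index n)"
  by (auto simp: inj_on_def cyc_index_def Cyc_eq_iff)

lemma inj_Dic: "inj_on Dic' (dic_index n)"
  by (auto simp: inj_on_def dic_index_def Dic_eq_iff)

lemma Cyc_Dic_disjoint: "Cyc ` cyc_index n \<inter> Dic' ` dic_index n = {}"
  using Cyc_neq_Dic by (fastforce simp: cyc_index_def dic_index_def)

lemma finite_cyc_index: "finite (cyc_index n)"
  using finite_divisors_nat[of "2 * n"] n_pos by (auto simp: cyc_index_def)

lemma finite_dic_index: "finite (dic_index n)"
proof (rule finite_subset)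
  show "dic_index n \<subseteq> {..n} \<times> {..<n}"
    using dvd_imp_le[OF _ n_pos] by (fastforce simp: dic_index_def)
qed simp

lemma Dic_mult_subset:
  assumes "d dvd n" "e dvd n" "int (gcd d e) dvd 2 * (i - j)"
  shows "Dic d i <#> Dic e j \<subseteq> Dic e j <#> Dic d i"
proof
  fix x assume "x \<in> Dic d i <#> Dic e j"
  then obtain y z where yz: "y \<in> Dic d i" "z \<in> Dic e j" "x = y \<otimes> z"
    unfolding set_mult_def by auto
  have mem: "s \<otimes> t \<in> Dic e j <#> Dic d i" if "s \<in> Dic e j" "t \<in> Dic d i" for s t
    using that unfolding set_mult_def by blast
  consider u v where "y = a u" "z = a v" "int d dvd u" "int e dvd v"
    | u v where "y = a u" "z = c v" "int d dvd u" "int e dvd v - j"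
    | u v where "y = c u" "z = a v" "int d dvd u - i" "int e dvd v"
    | u v where "y = c u" "z = c v" "int d dvd u - i" "int e dvd v - j"
    using yz(1,2) unfolding Dic_def by blast
  then show "x \<in> Dic e j <#> Dic d i"
  proof cases
    case 1
    then have "x = a v \<otimes> a u" by (simp add: yz mult_aa add.commute)
    then show ?thesis using 1 mem by (auto simp: Dic_def)
  next
    case 2
    then have "x = c v \<otimes> a (- u)" by (simp add: yz mult_ac mult_ca add.commute)
    then show ?thesis using 2 mem by (auto simp: Dic_def)
  next
    case 3
    then have "x = a (- v) \<otimes> c u" by (simp add: yz mult_ac mult_ca add.commute)
    then show ?thesis using 3 mem by (auto simp: Dic_def)
  next
    case 4
    \<comment> \<open>To reverse the order one needs
      \<open>c u \<otimes> c v = c v' \<otimes> c u'\<close> with u' = u - dX and v' = v + eY.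
      Comparing exponents, u - v = v' - u', which amounts to 2(u - v) = dX + eY. Bezout solves this
      because the gcd divides 2(u - v), as it divides 2(i - j).\<close>
    have "int (gcd d e) dvd u - i" "int (gcd d e) dvd v - j"
      using 4 by (meson dvd_trans gcd_dvd1 gcd_dvd2 int_dvd_int_iff)+
    then have "int (gcd d e) dvd 2 * ((u - i) - (v - j)) + 2 * (i - j)"
      using assms(3) by (intro dvd_add[OF dvd_mult[OF dvd_diff]])
    then have "gcd (int d) (int e) dvd 2 * (u - v)" by (simp add: algebra_simps gcd_int_int_eq)
    then obtain q where q: "2 * (u - v) = gcd (int d) (int e) * q" by (auto elim: dvdE)
    obtain s t where "s * int d + t * int e = gcd (int d) (int e)"
      using bezout_int by blast
    then have eq: "2 * (u - v) = int d * (s * q) + int e * (t * q)"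
      unfolding q by (metis (no_types, lifting) distrib_right mult.assoc mult.commute)
    define v' where "v' = v + int e * (t * q)"
    define u' where "u' = u - int d * (s * q)"
    have "u - v = v + Y - (u - X)" if "2 * (u - v) = X + Y" for X Y
      using that by (simp add: algebra_simps)
    from this[OF eq] have "u - v = v' - u'" unfolding v'_def u'_def .
    then have "x = c v' \<otimes> c u'"
      by (simp add: yz 4 mult_cc)
    moreover have "c v' \<in> Dic e j"
    proof -
      have "int e dvd (v - j) + int e * (t * q)" using 4 by (intro dvd_add) auto
      then show ?thesis unfolding Dic_def v'_def by (auto simp: algebra_simps)
    qed
    moreover have "c u' \<in> Dic d i"
    proof -
      have "int d dvd (u - i) - int d * (s * q)" by (intro dvd_diff[OF 4(3)]) simp
      then show ?thesis unfolding Dic_def u'_def by (auto simp: algebra_simps)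
    qed
    ultimately show ?thesis using mem by blast
  qed
qed

text \<open>For necessity, the product of \<open>c i\<close> and \<open>c j\<close> must reappear
  with the factors in reverse order. As a product of two powers of a it would give i = j modulo the
  gcd; as a product of two elements c it gives i - j = j - i, which is where the factor 2 comes
  from.\<close>

lemma Dic_permute_iff:
  assumes "d dvd n" "e dvd n"
  shows "Dic d i <#> Dic e j = Dic e j <#> Dic d i \<longleftrightarrow> int (gcd d e) dvd 2 * (i - j)"
proof
  let ?g = "int (gcd d e)"
  assume eq: "Dic d i <#> Dic e j = Dic e j <#> Dic d i"
  have "c i \<in> Dic d i" "c j \<in> Dic e j" by (auto simp: Dic_def)
  then have "c i \<otimes> c j \<in> Dic d i <#> Dic e j" unfolding set_mult_def by blast
  then have "a (i - j + int n) \<in> Dic e j <#> Dic d i" by (simp add: eq mult_cc)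
  then obtain y z where yz: "y \<in> Dic e j" "z \<in> Dic d i" "a (i - j + int n) = y \<otimes> z"
    unfolding set_mult_def by auto
  have gn: "?g dvd int n" using assms by (simp add: dvd_trans[OF gcd_dvd1])
  then have g2n: "?g dvd 2 * int n" by simp
  have g: "?g dvd int d" "?g dvd int e" by simp_all
  consider u v where "y = a u" "z = a v" "int e dvd u" "int d dvd v"
    | u v where "y = a u" "z = c v"
    | u v where "y = c u" "z = a v"
    | u v where "y = c u" "z = c v" "int e dvd u - j" "int d dvd v - i"
    using yz(1,2) unfolding Dic_def by blast
  then show "?g dvd 2 * (i - j)"
  proof cases
    case 1
    then have "[i - j + int n = u + v] (mod 2 * int n)"
      using yz(3) by (simp add: mult_aa a_eq_iff)
    then have "?g dvd (i - j + int n) - (u + v)"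
      using g2n by (meson cong_iff_dvd_diff dvd_trans)
    moreover have "?g dvd (u + v) - int n"
      using 1 g gn by (meson dvd_add dvd_diff dvd_trans)
    ultimately have "?g dvd ((i - j + int n) - (u + v)) + ((u + v) - int n)" by (rule dvd_add)
    then have "?g dvd i - j" by simp
    then show ?thesis by (rule dvd_mult)
  next
    case 4
    then have "[i - j + int n = u - v + int n] (mod 2 * int n)"
      using yz(3) by (simp add: mult_cc a_eq_iff)
    then have "?g dvd (i - j + int n) - (u - v + int n)"
      using g2n by (meson cong_iff_dvd_diff dvd_trans)
    moreover have "?g dvd (u - j) - (v - i)"
      using 4 g by (meson dvd_diff dvd_trans)
    ultimately have "?g dvd ((i - j + int n) - (u - v + int n)) + ((u - j) - (v - i))"
      by (rule dvd_add)
    then show ?thesis by (simp add: algebra_simps)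
  qed (use yz(3) in \<open>simp_all add: mult_ac mult_ca a_neq_c\<close>)
next
  assume "int (gcd d e) dvd 2 * (i - j)"
  moreover from this have "int (gcd e d) dvd 2 * (j - i)"
    using dvd_minus_iff[of "int (gcd d e)" "2 * (i - j)"] by (simp add: gcd.commute)
  ultimately show "Dic d i <#> Dic e j = Dic e j <#> Dic d i"
    using Dic_mult_subset assms by blast
qed

lemma Dic_arc_iff:
  assumes "x \<in> dic_index n" "y \<in> dic_index n"
  shows "(Dic' x, Dic' y) \<in> parcs (subgroup_graph G) \<longleftrightarrow> dic_adj x y"
proof -
  have "Dic' x \<in> pverts (subgroup_graph G)" "Dic' y \<in> pverts (subgroup_graph G)"
    using assms by (auto simp: pverts_subgroup_graph)
  then have "(Dic' x, Dic' y) \<in> parcs (subgroup_graph G) \<longleftrightarrow>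
      Dic' x \<noteq> Dic' y \<and> Dic' x <#> Dic' y = Dic' y <#> Dic' x"
    by (simp add: subgroup_graph_def Let_def)
  moreover have "Dic' x = Dic' y \<longleftrightarrow> x = y"
    using inj_on_eq_iff[OF inj_Dic assms] .
  moreover have "fst x dvd n" "fst y dvd n" using assms by (auto simp: dic_index_def)
  ultimately show ?thesis
    by (simp only: Dic_permute_iff dic_adj_def)
qed

lemma Cyc_arc:
  assumes "d \<in> cyc_index n" "H \<in> pverts (subgroup_graph G)" "H \<noteq> Cyc d"
  shows "(Cyc d, H) \<in> parcs (subgroup_graph G)" "(H, Cyc d) \<in> parcs (subgroup_graph G)"
proof -
  have "Cyc d \<in> pverts (subgroup_graph G)" using assms by (simp add: pverts_subgroup_graph)
  moreover have "subgroup H G" using assms by (simp add: subgroup_graph_def Let_def)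
  then have "H <#> Cyc d = Cyc d <#> H" using commut_normal normal_Cyc by blast
  ultimately show "(Cyc d, H) \<in> parcs (subgroup_graph G)" "(H, Cyc d) \<in> parcs (subgroup_graph G)"
    using assms by (auto simp: subgroup_graph_def Let_def)
qed

lemma hamiltonian_Dic_path_cover:
  assumes "set (concat ps) = dic_index n" "distinct (concat ps)"
    and "\<forall>p \<in> set ps. successively dic_adj p"
    and len: "length ps \<le> card (cyc_index n)" and large: "card (dic_index n) \<ge> 2"
  shows "hamiltonian (subgroup_graph G)"
proof (rule hamiltonian_path_cover[where U = "Cyc ` cyc_index n" and ps = "map (map Dic') ps"])
  have conc: "concat (map (map Dic') ps) = map Dic' (concat ps)" by (simp add: map_concat)
  show "pverts (subgroup_graph G) = Cyc ` cyc_index n \<union> set (concat (map (map Dic') ps))"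
    unfolding conc using assms(1) by (simp only: pverts_subgroup_graph set_map)
  show "Cyc ` cyc_index n \<inter> set (concat (map (map Dic') ps)) = {}"
    unfolding conc set_map assms(1) by (rule Cyc_Dic_disjoint)
  show "finite (Cyc ` cyc_index n)" using finite_cyc_index by simp
  have one: "1 \<in> cyc_index n" using n_pos by (auto simp: cyc_index_def)
  then show "Cyc ` cyc_index n \<noteq> {}" by blast
  show "length (map (map Dic') ps) \<le> card (Cyc ` cyc_index n)"
    using len by (simp add: card_image inj_Cyc)
  show "distinct (concat (map (map Dic') ps))"
    unfolding conc distinct_map using assms(1,2) inj_Dic by simp
  show "successively (\<lambda>x y. (x, y) \<in> parcs (subgroup_graph G)) p" if "p \<in> set (map (map Dic') ps)" for p
  proof -
    from that obtain q where q: "q \<in> set ps" "p = map Dic' q" by auto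
    then have "set q \<subseteq> dic_index n" using assms(1) by auto
    then show ?thesis
      unfolding q successively_map
      using q assms(3) Dic_arc_iff by (blast intro: successively_mono)
  qed
  show "(u, x) \<in> parcs (subgroup_graph G) \<and> (x, u) \<in> parcs (subgroup_graph G)"
    if "u \<in> Cyc ` cyc_index n" "x \<in> pverts (subgroup_graph G)" "u \<noteq> x" for u x
    using that Cyc_arc by blast
  have "card (pverts (subgroup_graph G)) = card (cyc_index n) + card (dic_index n)"
    unfolding pverts_subgroup_graph using finite_cyc_index finite_dic_index
    by (subst card_Un_disjoint) (simp_all add: Cyc_Dic_disjoint card_image inj_Cyc inj_Dic)
  moreover have "card (cyc_index n) > 0" using one finite_cyc_index by (auto simp: card_gt_0_iff)
  ultimately show "3 \<le> card (pverts (subgroup_graph G))" using large by simp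
qed

text \<open>The removed vertices are all cyclic subgroups and the dicyclic ones with index outside
  \<open>L\<close>; each colour of \<open>f\<close> on \<open>L\<close> stands for at least one
  component of the rest.\<close>

lemma not_hamiltonian_colours:
  assumes "L \<subseteq> dic_index n"
    and colour: "\<And>x y. x \<in> L \<Longrightarrow> y \<in> L \<Longrightarrow> dic_adj x y \<Longrightarrow> f x = f y"
    and card: "card (cyc_index n) + card (dic_index n - L) < card (f ` L)"
  shows "\<not> hamiltonian (subgroup_graph G)"
proof
  assume ham: "hamiltonian (subgroup_graph G)"
  define U where "U = Cyc ` cyc_index n \<union> Dic' ` (dic_index n - L)"
  \<comment> \<open>Colours are given on indices, and \<open>h\<close> carries them over to
    subgroups.\<close>
  define h where "h = the_inv_into (dic_index n) Dic'"
  have h: "h (Dic' x) = x" if "x \<in> dic_index n" for x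
    unfolding h_def using the_inv_into_f_f[OF inj_Dic that] .
  have rest: "pverts (subgroup_graph G) - U = Dic' ` L"
  proof -
    have "Dic' ` (dic_index n - L) = Dic' ` dic_index n - Dic' ` L"
      using inj_on_image_set_diff[OF inj_Dic, of "dic_index n" L] assms(1) by simp
    moreover have "Dic' ` L \<subseteq> Dic' ` dic_index n" using assms(1) by (rule image_mono)
    moreover have "(A \<union> B) - (A \<union> (B - C)) = C" if "A \<inter> B = {}" "C \<subseteq> B" for A B C :: "'a set set"
      using that by blast
    ultimately show ?thesis
      unfolding pverts_subgroup_graph U_def using Cyc_Dic_disjoint by simp
  qed
  have "card ((f \<circ> h) ` (pverts (subgroup_graph G) - U)) \<le> card U"
  proof (rule hamiltonian_colours_le[OF ham])
    show "U \<subseteq> pverts (subgroup_graph G)" by (auto simp: U_def pverts_subgroup_graph)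
    show "finite U" using finite_cyc_index finite_dic_index by (simp add: U_def)
    have "1 \<in> cyc_index n" using n_pos by (auto simp: cyc_index_def)
    then show "U \<noteq> {}" by (auto simp: U_def)
    show "y \<in> pverts (subgroup_graph G)" if "(x, y) \<in> parcs (subgroup_graph G)" for x y
      using that by (auto simp: subgroup_graph_def Let_def)
    show "(f \<circ> h) X = (f \<circ> h) Y"
      if arc: "(X, Y) \<in> parcs (subgroup_graph G)" "X \<notin> U" "Y \<notin> U" for X Y
    proof -
      have "X \<in> pverts (subgroup_graph G) - U" "Y \<in> pverts (subgroup_graph G) - U"
        using arc by (auto simp: subgroup_graph_def Let_def)
      then obtain x y where xy: "x \<in> L" "X = Dic' x" "y \<in> L" "Y = Dic' y"
        unfolding rest by blast
      then have "dic_adj x y" using arc(1) Dic_arc_iff assms(1) by blast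
      then have "f x = f y" using colour xy by blast
      moreover have "h X = x" "h Y = y" using xy h assms(1) by blast+
      ultimately show ?thesis by simp
    qed
  qed
  moreover have "(f \<circ> h) ` (pverts (subgroup_graph G) - U) = f ` L"
    unfolding rest image_image using h assms(1) by (intro image_cong) auto
  moreover have "card U \<le> card (cyc_index n) + card (dic_index n - L)"
    unfolding U_def using finite_cyc_index finite_dic_index
    by (intro order_trans[OF card_Un_le] add_mono card_image_le) auto
  ultimately show False using card by simp
qed

end

section \<open>Normal forms in the presented group\<close>

text \<open>Left multiplication of letters on normal forms \<open>a\<^sup>i b\<^sup>e\<close> with an unreduced exponent \<open>i\<close>; the
  defining relations hold for it modulo \<open>2 n\<close>.\<close>

fun Q_act :: "nat \<Rightarrow> Q_gen \<times> bool \<Rightarrow> int \<times> bool \<Rightarrow> int \<times> bool" where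
  "Q_act n (Gen_a, True) (i, e) = (i + 1, e)"
| "Q_act n (Gen_a, False) (i, e) = (i - 1, e)"
| "Q_act n (Gen_b, True) (i, e) = (if e then int n - i else - i, \<not> e)"
| "Q_act n (Gen_b, False) (i, e) = (if e then - i else int n - i, \<not> e)"

text \<open>Since exponents remain integers, a letter and its formal inverse cancel exactly under
  \<open>Q_act\<close>. The modulus is needed only for the defining relations.\<close>

definition Q_eqv :: "nat \<Rightarrow> int \<times> bool \<Rightarrow> int \<times> bool \<Rightarrow> bool" where
  "Q_eqv n s t \<longleftrightarrow> [fst s = fst t] (mod 2 * int n) \<and> snd s = snd t"

lemma Q_eqv_refl [simp]: "Q_eqv n s s"
  and Q_eqv_sym: "Q_eqv n s t \<Longrightarrow> Q_eqv n t s"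
  and Q_eqv_trans: "Q_eqv n s t \<Longrightarrow> Q_eqv n t u \<Longrightarrow> Q_eqv n s u"
  by (auto simp: Q_eqv_def intro: cong_sym cong_trans)

lemma Q_act_eqv:
  assumes "Q_eqv n s t"
  shows "Q_eqv n (Q_act n l s) (Q_act n l t)"
proof -
  obtain x e where l: "l = (x, e)" by (cases l)
  obtain i f where s: "s = (i, f)" by (cases s)
  obtain j where t: "t = (j, f)" and ij: "[i = j] (mod 2 * int n)"
    using assms s by (cases t) (auto simp: Q_eqv_def)
  show ?thesis
    unfolding l s t using ij
    by (cases x; cases e) (auto simp: Q_eqv_def intro: cong_add cong_diff cong_minus_minus_iff[THEN iffD2])
qed

lemma Q_word_act_eqv: "Q_eqv n s t \<Longrightarrow> Q_eqv n (foldr (Q_act n) w s) (foldr (Q_act n) w t)"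
  by (induction w) (auto intro: Q_act_eqv)

lemma Q_act_power:
  "(Q_act n (Gen_a, True) ^^ k) (i, e) = (i + int k, e)"
  "(Q_act n (Gen_a, False) ^^ k) (i, e) = (i - int k, e)"
  by (induction k) auto

lemma word_pow_letter: "word_pow [l] k = replicate k l"
  by (induction k) (auto simp: word_pow_def)

lemma Q_relation_act:
  assumes "(u, v) \<in> Q_relations n"
  shows "Q_eqv n (foldr (Q_act n) u (i, e)) (foldr (Q_act n) v (i, e))"
  using assms
  by (auto simp: Q_relations_def word_pow_letter Q_act_power eval_nat_numeral Q_eqv_def
      cong_iff_dvd_diff)

text \<open>This bounds the presented group from below: words that act differently on a single
  normal form represent different elements.\<close>

lemma pres_eq_act:
  assumes "pres_eq (Q_relations n) u v"
  shows "Q_eqv n (foldr (Q_act n) u s) (foldr (Q_act n) v s)"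
  using assms
proof (induction arbitrary: s rule: pres_eq.induct)
  case (pres_append u u' v v')
  have "Q_eqv n (foldr (Q_act n) u (foldr (Q_act n) v s)) (foldr (Q_act n) u (foldr (Q_act n) v' s))"
    by (intro Q_word_act_eqv pres_append.IH)
  then show ?case
    unfolding foldr_append comp_apply by (rule Q_eqv_trans) (rule pres_append.IH(1))
next
  case (pres_trans u v w)
  show ?case by (rule Q_eqv_trans[OF pres_trans.IH])
next
  case (pres_cancel x e)
  then show ?case by (cases s; cases x; cases e) auto
next
  case (pres_rel u v)
  then show ?case using Q_relation_act by (cases s) auto
qed (auto intro: Q_eqv_sym)

section \<open>The presented group satisfies the dicyclic multiplication rules\<close>

context
  fixes n :: nat
  assumes n_pos: "n > 0"
begin

abbreviation "Q \<equiv> Q_group n"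
abbreviation "cls \<equiv> pres_class (Q_relations n)"

definition Q_pow_a :: "int \<Rightarrow> Q_gen word set" where
  "Q_pow_a k = cls Q_a [^]\<^bsub>Q\<^esub> k"

definition Q_pow_a_b :: "int \<Rightarrow> Q_gen word set" where
  "Q_pow_a_b k = Q_pow_a k \<otimes>\<^bsub>Q\<^esub> cls Q_b"

interpretation Q: group Q
  unfolding Q_group_def by (rule group_presented_group)

lemma cls_carrier [simp]: "cls w \<in> carrier Q"
  by (simp add: Q_group_def presented_group_def)

lemma cls_mult: "cls u \<otimes>\<^bsub>Q\<^esub> cls v = cls (u @ v)"
  by (simp add: Q_group_def presented_group_mult)

lemma one_cls: "\<one>\<^bsub>Q\<^esub> = cls []"
  by (simp add: Q_group_def presented_group_def)

lemma cls_word_pow: "cls w [^]\<^bsub>Q\<^esub> k = cls (word_pow w k)"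
proof (induction k)
  case (Suc k)
  have "word_pow w (Suc k) = word_pow w k @ w"
    unfolding word_pow_def replicate_Suc replicate_append_same[symmetric] by simp
  then show ?case using Suc by (simp add: cls_mult)
qed (simp add: one_cls word_pow_def)

lemma cls_inverse_letter: "inv\<^bsub>Q\<^esub> (cls [(x, e)]) = cls [(x, \<not> e)]"
proof (rule Q.inv_equality)
  have "pres_eq (Q_relations n) [(x, \<not> e), (x, \<not> \<not> e)] []" by (rule pres_cancel)
  then show "cls [(x, \<not> e)] \<otimes>\<^bsub>Q\<^esub> cls [(x, e)] = \<one>\<^bsub>Q\<^esub>"
    by (simp add: cls_mult one_cls pres_class_eq_iff)
qed simp_all

lemma cls_relation: "(u, v) \<in> Q_relations n \<Longrightarrow> cls u = cls v"
  by (simp add: pres_class_eq_iff pres_rel)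

lemma Q_pow_a_carrier [simp]: "Q_pow_a k \<in> carrier Q"
  by (simp add: Q_pow_a_def)

lemma Q_pow_a_b_carrier [simp]: "Q_pow_a_b k \<in> carrier Q"
  by (simp add: Q_pow_a_b_def)

lemma Q_pow_a_add: "Q_pow_a i \<otimes>\<^bsub>Q\<^esub> Q_pow_a j = Q_pow_a (i + j)"
  by (simp add: Q_pow_a_def Q.int_pow_mult)

lemma Q_pow_a_0: "Q_pow_a 0 = \<one>\<^bsub>Q\<^esub>"
  by (simp add: Q_pow_a_def)

lemma Q_pow_a_period: "Q_pow_a (2 * int n * t) = \<one>\<^bsub>Q\<^esub>"
proof -
  have "cls Q_a [^]\<^bsub>Q\<^esub> (2 * int n) = cls Q_a [^]\<^bsub>Q\<^esub> (2 * n)"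
    by (metis int_pow_int of_nat_mult of_nat_numeral)
  also have "\<dots> = \<one>\<^bsub>Q\<^esub>"
    unfolding cls_word_pow one_cls by (rule cls_relation) (simp add: Q_relations_def)
  finally have "(cls Q_a [^]\<^bsub>Q\<^esub> (2 * int n)) [^]\<^bsub>Q\<^esub> t = \<one>\<^bsub>Q\<^esub>" by simp
  then show ?thesis by (simp add: Q_pow_a_def Q.int_pow_pow)
qed

lemma Q_b_square: "cls Q_b \<otimes>\<^bsub>Q\<^esub> cls Q_b = Q_pow_a (int n)"
proof -
  have "cls (word_pow Q_b 2) = cls (word_pow Q_a n)"
    by (rule cls_relation) (simp add: Q_relations_def)
  then have "cls Q_b \<otimes>\<^bsub>Q\<^esub> cls Q_b = cls Q_a [^]\<^bsub>Q\<^esub> n"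
    by (simp add: cls_word_pow cls_mult word_pow_def eval_nat_numeral)
  then show ?thesis by (simp add: Q_pow_a_def int_pow_int)
qed

lemma Q_b_conj: "Q_pow_a j \<otimes>\<^bsub>Q\<^esub> cls Q_b = cls Q_b \<otimes>\<^bsub>Q\<^esub> Q_pow_a (- j)"
proof -
  let ?a = "cls Q_a" and ?b = "cls Q_b"
  have "cls (Q_a @ Q_b) = cls (Q_b @ Q_a_inv)"
    by (rule cls_relation) (simp add: Q_relations_def)
  then have ab: "?a \<otimes>\<^bsub>Q\<^esub> ?b = ?b \<otimes>\<^bsub>Q\<^esub> inv\<^bsub>Q\<^esub> ?a"
    by (simp add: cls_mult cls_inverse_letter)
  have nat: "?a [^]\<^bsub>Q\<^esub> k \<otimes>\<^bsub>Q\<^esub> ?b = ?b \<otimes>\<^bsub>Q\<^esub> (inv\<^bsub>Q\<^esub> ?a) [^]\<^bsub>Q\<^esub> k" for k :: nat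
  proof (induction k)
    case (Suc k)
    have "?a [^]\<^bsub>Q\<^esub> Suc k \<otimes>\<^bsub>Q\<^esub> ?b = ?a [^]\<^bsub>Q\<^esub> k \<otimes>\<^bsub>Q\<^esub> (?a \<otimes>\<^bsub>Q\<^esub> ?b)"
      by (simp add: Q.m_assoc)
    also have "\<dots> = (?a [^]\<^bsub>Q\<^esub> k \<otimes>\<^bsub>Q\<^esub> ?b) \<otimes>\<^bsub>Q\<^esub> inv\<^bsub>Q\<^esub> ?a"
      unfolding ab by (simp add: Q.m_assoc)
    also have "\<dots> = ?b \<otimes>\<^bsub>Q\<^esub> (inv\<^bsub>Q\<^esub> ?a) [^]\<^bsub>Q\<^esub> Suc k"
      unfolding Suc by (simp add: Q.m_assoc)
    finally show ?case .
  qed simp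
  have pos: "Q_pow_a (int k) \<otimes>\<^bsub>Q\<^esub> ?b = ?b \<otimes>\<^bsub>Q\<^esub> Q_pow_a (- int k)" for k
    using nat[of k] by (simp add: Q_pow_a_def int_pow_int Q.int_pow_neg Q.nat_pow_inv)
  show ?thesis
  proof (cases "j \<ge> 0")
    case True
    then show ?thesis using pos[of "nat j"] by simp
  next
    case False
    then have p: "Q_pow_a (- j) \<otimes>\<^bsub>Q\<^esub> ?b = ?b \<otimes>\<^bsub>Q\<^esub> Q_pow_a j" using pos[of "nat (- j)"] by simp
    \<comment> \<open>Inserting a^j a^(-j) on the right makes b a^j appear, so that the rule for the
      positive exponent -j applies backwards.\<close>
    have "Q_pow_a j \<otimes>\<^bsub>Q\<^esub> ?b = Q_pow_a j \<otimes>\<^bsub>Q\<^esub> (?b \<otimes>\<^bsub>Q\<^esub> Q_pow_a j) \<otimes>\<^bsub>Q\<^esub> Q_pow_a (- j)"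
      by (simp add: Q.m_assoc Q_pow_a_add Q_pow_a_0)
    also have "\<dots> = (Q_pow_a j \<otimes>\<^bsub>Q\<^esub> Q_pow_a (- j)) \<otimes>\<^bsub>Q\<^esub> ?b \<otimes>\<^bsub>Q\<^esub> Q_pow_a (- j)"
      unfolding p[symmetric] by (simp add: Q.m_assoc)
    finally show ?thesis by (simp add: Q_pow_a_add Q_pow_a_0)
  qed
qed

text \<open>Provides a representing word for every integer power whose action is a translation, so
  the exponent can be read off modulo 2n.\<close>

lemma Q_act_pow_a: "\<exists>w. Q_pow_a k = cls w \<and> (\<forall>i e. foldr (Q_act n) w (i, e) = (i + k, e))"
proof (cases "k \<ge> 0")
  case True
  have "Q_pow_a k = cls (replicate (nat k) (Gen_a, True))"
    using True by (simp add: Q_pow_a_def int_pow_def2 cls_word_pow word_pow_letter)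
  then show ?thesis
    using True by (intro exI[of _ "replicate (nat k) (Gen_a, True)"]) (simp add: Q_act_power)
next
  case False
  have "Q_pow_a k = inv\<^bsub>Q\<^esub> (cls Q_a [^]\<^bsub>Q\<^esub> nat (- k))"
    unfolding Q_pow_a_def using False by (subst int_pow_def2) simp
  also have "\<dots> = (inv\<^bsub>Q\<^esub> (cls Q_a)) [^]\<^bsub>Q\<^esub> nat (- k)"
    by (simp only: Q.nat_pow_inv cls_carrier)
  also have "\<dots> = cls (replicate (nat (- k)) (Gen_a, False))"
    by (simp add: cls_inverse_letter cls_word_pow word_pow_letter)
  finally show ?thesis
    using False by (intro exI[of _ "replicate (nat (- k)) (Gen_a, False)"]) (simp add: Q_act_power)
qed

lemma dicyclic_Q_group: "dicyclic Q n Q_pow_a Q_pow_a_b"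
proof unfold_locales
  show "n > 0" by (rule n_pos)
  show aa: "Q_pow_a i \<otimes>\<^bsub>Q\<^esub> Q_pow_a j = Q_pow_a (i + j)" for i j by (rule Q_pow_a_add)
  show ac: "Q_pow_a i \<otimes>\<^bsub>Q\<^esub> Q_pow_a_b j = Q_pow_a_b (i + j)" for i j
    by (simp add: Q_pow_a_b_def Q_pow_a_add flip: Q.m_assoc)
  have ba: "cls Q_b \<otimes>\<^bsub>Q\<^esub> Q_pow_a j = Q_pow_a_b (- j)" for j
    using Q_b_conj[of "- j"] by (simp add: Q_pow_a_b_def)
  show ca: "Q_pow_a_b i \<otimes>\<^bsub>Q\<^esub> Q_pow_a j = Q_pow_a_b (i - j)" for i j
    using ac[of i "- j"] by (simp add: Q_pow_a_b_def[of i] Q.m_assoc ba)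
  show cc: "Q_pow_a_b i \<otimes>\<^bsub>Q\<^esub> Q_pow_a_b j = Q_pow_a (i - j + int n)" for i j
  proof -
    have "Q_pow_a_b i \<otimes>\<^bsub>Q\<^esub> Q_pow_a_b j = (Q_pow_a_b i \<otimes>\<^bsub>Q\<^esub> Q_pow_a j) \<otimes>\<^bsub>Q\<^esub> cls Q_b"
      by (simp add: Q_pow_a_b_def[of j] Q.m_assoc)
    also have "\<dots> = Q_pow_a (i - j) \<otimes>\<^bsub>Q\<^esub> (cls Q_b \<otimes>\<^bsub>Q\<^esub> cls Q_b)"
      by (simp add: ca Q_pow_a_b_def[of "i - j"] Q.m_assoc)
    finally show ?thesis by (simp add: Q_b_square aa)
  qed
  have a_imp: "Q_pow_a i = Q_pow_a j" if "[i = j] (mod 2 * int n)" for i j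
  proof -
    from that have "2 * int n dvd i - j" by (simp add: cong_iff_dvd_diff)
    then obtain t where "i - j = 2 * int n * t" by (rule dvdE)
    then have "i = j + 2 * int n * t" by simp
    then have "Q_pow_a i = Q_pow_a j \<otimes>\<^bsub>Q\<^esub> Q_pow_a (2 * int n * t)" by (simp add: aa)
    then show ?thesis by (simp add: Q_pow_a_period)
  qed
  have act: "Q_eqv n (i, False) (j, False)" if "Q_pow_a i = Q_pow_a j" for i j
  proof -
    obtain u where u: "Q_pow_a i = cls u" "\<And>k e. foldr (Q_act n) u (k, e) = (k + i, e)"
      using Q_act_pow_a by blast
    obtain v where v: "Q_pow_a j = cls v" "\<And>k e. foldr (Q_act n) v (k, e) = (k + j, e)"
      using Q_act_pow_a by blast
    have "pres_eq (Q_relations n) u v" using that u v by (simp flip: pres_class_eq_iff)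
    from pres_eq_act[OF this, of "(0, False)"] show ?thesis by (simp add: u v)
  qed
  show a_eq: "Q_pow_a i = Q_pow_a j \<longleftrightarrow> [i = j] (mod 2 * int n)" for i j
    using act[of i j] a_imp[of i j] by (auto simp: Q_eqv_def)
  show "Q_pow_a_b i = Q_pow_a_b j \<longleftrightarrow> [i = j] (mod 2 * int n)" for i j
    by (simp add: Q_pow_a_b_def a_eq)
  show "Q_pow_a i \<noteq> Q_pow_a_b j" for i j
  proof
    assume eq: "Q_pow_a i = Q_pow_a_b j"
    obtain u where u: "Q_pow_a i = cls u" "\<And>k e. foldr (Q_act n) u (k, e) = (k + i, e)"
      using Q_act_pow_a by blast
    obtain v where v: "Q_pow_a j = cls v" "\<And>k e. foldr (Q_act n) v (k, e) = (k + j, e)"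
      using Q_act_pow_a by blast
    \<comment> \<open>The action of \<open>u\<close> keeps the second component of a normal form,
      that of \<open>v @ Q_b\<close> flips it.\<close>
    have "pres_eq (Q_relations n) u (v @ Q_b)"
      using eq u v by (simp add: Q_pow_a_b_def cls_mult flip: pres_class_eq_iff)
    from pres_eq_act[OF this, of "(0, False)"] show False by (simp add: u v Q_eqv_def)
  qed
  have letter: "\<exists>i. cls [l] = Q_pow_a i \<or> cls [l] = Q_pow_a_b i" for l
  proof -
    obtain x e where l: "l = (x, e)" by (cases l)
    have "cls Q_a = Q_pow_a 1" by (simp add: Q_pow_a_def)
    moreover have "cls Q_a_inv = Q_pow_a (- 1)"
      using cls_inverse_letter[of Gen_a True] by (simp add: Q_pow_a_def Q.int_pow_neg)
    moreover have "cls Q_b = Q_pow_a_b 0" by (simp add: Q_pow_a_b_def Q_pow_a_0)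
    \<comment> \<open>The inverse of b is a^n b, because b^2 = a^n and a^(2n) is the
      identity.\<close>
    moreover have "cls [(Gen_b, False)] = Q_pow_a_b (int n)"
    proof -
      have "Q_pow_a_b (int n) \<otimes>\<^bsub>Q\<^esub> Q_pow_a_b 0 = Q_pow_a (2 * int n * 1)"
        by (simp add: cc)
      then have "inv\<^bsub>Q\<^esub> (cls Q_b) = Q_pow_a_b (int n)"
        unfolding Q_pow_a_period using \<open>cls Q_b = _\<close> by (intro Q.inv_equality) simp_all
      then show ?thesis using cls_inverse_letter[of Gen_b True] by simp
    qed
    ultimately show ?thesis unfolding l by (cases x; cases e) auto
  qed
  have "\<exists>i. cls w = Q_pow_a i \<or> cls w = Q_pow_a_b i" for w
  proof (induction w)
    case Nil
    then show ?case using Q_pow_a_0 one_cls by metis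
  next
    case (Cons l w)
    have "cls (l # w) = cls [l] \<otimes>\<^bsub>Q\<^esub> cls w" by (simp add: cls_mult)
    then show ?case using letter[of l] Cons by (auto simp: aa ac ca cc)
  qed
  then have "range cls \<subseteq> range Q_pow_a \<union> range Q_pow_a_b" by blast
  moreover have "carrier Q = range cls" by (simp add: Q_group_def presented_group_def)
  moreover have "range Q_pow_a \<union> range Q_pow_a_b \<subseteq> carrier Q" by auto
  ultimately show "carrier Q = range Q_pow_a \<union> range Q_pow_a_b" by (simp only: subset_antisym)
qed

end

section \<open>Path covers and colourings\<close>

lemma dic_adj_dvdI:
  assumes "d dvd e" "int d dvd 2 * (int i - int j)" "(d, i) \<noteq> (e, j)"
  shows "dic_adj (d, i) (e, j)" "dic_adj (e, j) (d, i)"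
proof -
  have "int d dvd 2 * (int j - int i)"
    using assms(2) by (metis dvd_minus_iff minus_diff_eq mult_minus_right)
  then show "dic_adj (d, i) (e, j)" "dic_adj (e, j) (d, i)"
    using assms by (auto simp: dic_adj_def gcd_nat.absorb1 gcd_nat.absorb2)
qed

text \<open>Splits the residue class of a tree node into the classes of its two children.\<close>

lemma mod_double_iff:
  fixes j m r :: nat
  assumes "r < m"
  shows "j mod m = r \<longleftrightarrow> j mod (2 * m) = r \<or> j mod (2 * m) = r + m"
proof -
  define t where "t = j mod (2 * m)"
  have t: "t < 2 * m" "j mod m = t mod m"
    using assms by (simp_all add: t_def mod_mod_cancel)
  show ?thesis
  proof (cases "t < m")
    case True
    then show ?thesis using t assms by (auto simp flip: t_def)
  next
    case False
    then have "t mod m = t - m" using t by (simp add: le_mod_geq)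
    then show ?thesis using False t assms by (auto simp flip: t_def)
  qed
qed

text \<open>For \<open>n = 2\<^sup>\<alpha>\<close> the dicyclic subgroups \<open>(2\<^sup>l, j)\<close> and \<open>(2\<^sup>l, j + 2\<^sup>l\<^sup>-\<^sup>1)\<close> form the nodes of a complete
  binary tree, and a node is adjacent to all its descendants. Consecutive nodes of the in-order
  traversal are comparable.\<close>

fun tree_path :: "nat \<Rightarrow> nat \<Rightarrow> nat \<Rightarrow> (nat \<times> nat) list" where
  "tree_path 0 k r = []"
| "tree_path (Suc m) k r = tree_path m (Suc k) r @
     [(2 ^ Suc k, r), (2 ^ Suc k, r + 2 ^ k)] @ tree_path m (Suc k) (r + 2 ^ k)"

text \<open>The parameters describe a subtree: \<open>m\<close> levels, with exponents above
  \<open>k\<close>, inside the class of \<open>r\<close> modulo 2^k. Below its root, an index goes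
  left or right according to its residue modulo 2^(k+1).\<close>

lemma set_tree_path:
  "r < 2 ^ k \<Longrightarrow>
    set (tree_path m k r) = {(2 ^ l, j) | l j. k < l \<and> l \<le> k + m \<and> j < 2 ^ l \<and> j mod 2 ^ k = r}"
proof (induction m arbitrary: k r)
  case 0
  then show ?case by auto
next
  case (Suc m)
  let ?T = "\<lambda>r. {(2 ^ l, j) | l j. Suc k < l \<and> l \<le> Suc k + m \<and> j < 2 ^ l \<and> j mod 2 ^ Suc k = r}"
  have r: "r < 2 ^ Suc k" "r + 2 ^ k < 2 ^ Suc k" using Suc.prems by simp_all
  have mod_iff: "j mod 2 ^ k = r \<longleftrightarrow> j mod 2 ^ Suc k = r \<or> j mod 2 ^ Suc k = r + 2 ^ k" for j
    using mod_double_iff[OF Suc.prems] by simp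
  have "set (tree_path (Suc m) k r) =
      ?T r \<union> {(2 ^ Suc k, r), (2 ^ Suc k, r + 2 ^ k)} \<union> ?T (r + 2 ^ k)"
    using Suc.IH[OF r(1)] Suc.IH[OF r(2)] by auto
  also have "\<dots> = {(2 ^ l, j) | l j. k < l \<and> l \<le> k + Suc m \<and> j < 2 ^ l \<and> j mod 2 ^ k = r}"
    (is "?L = ?R")
  proof (intro equalityI subsetI)
    fix x assume "x \<in> ?L"
    then consider l j where "x = (2 ^ l, j)" "Suc k < l" "l \<le> Suc k + m" "j < 2 ^ l"
        "j mod 2 ^ Suc k = r \<or> j mod 2 ^ Suc k = r + 2 ^ k"
      | j where "x = (2 ^ Suc k, j)" "j = r \<or> j = r + 2 ^ k"
      by blast
    then show "x \<in> ?R"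
    proof cases
      case 1
      then have "j mod 2 ^ k = r" by (simp only: mod_iff)
      then show ?thesis using 1 by auto
    next
      case 2
      then have "j < 2 ^ Suc k" using r by auto
      then have "j mod 2 ^ k = r" using 2 by (simp only: mod_iff mod_less)
      then show ?thesis using 2 \<open>j < _\<close> by (intro CollectI exI[of _ "Suc k"] exI[of _ j]) simp
    qed
  next
    fix x assume "x \<in> ?R"
    then obtain l j where x: "x = (2 ^ l, j)" "k < l" "l \<le> k + Suc m" "j < 2 ^ l" "j mod 2 ^ k = r"
      by blast
    show "x \<in> ?L"
    proof (cases "l = Suc k")
      case True
      then have "j = r \<or> j = r + 2 ^ k" using x(4,5) by (simp only: mod_iff mod_less)
      then show ?thesis using True x by blast
    next
      case False
      then have "Suc k < l" "l \<le> Suc k + m" using x by auto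
      then show ?thesis using x(1,4,5) unfolding mod_iff by blast
    qed
  qed
  finally show ?case .
qed

lemma distinct_tree_path: "r < 2 ^ k \<Longrightarrow> distinct (tree_path m k r)"
proof (induction m arbitrary: k r)
  case (Suc m)
  have r: "r < 2 ^ Suc k" "r + 2 ^ k < 2 ^ Suc k" using Suc.prems by simp_all
  have "(2 ^ Suc k, j) \<notin> set (tree_path m (Suc k) r)"
    "(2 ^ Suc k, j) \<notin> set (tree_path m (Suc k) (r + 2 ^ k))" for j
    unfolding set_tree_path[OF r(1)] set_tree_path[OF r(2)]
    by (auto simp del: power_Suc)
  moreover have "set (tree_path m (Suc k) r) \<inter> set (tree_path m (Suc k) (r + 2 ^ k)) = {}"
    unfolding set_tree_path[OF r(1)] set_tree_path[OF r(2)] by auto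
  ultimately show ?case using Suc.IH[OF r(1)] Suc.IH[OF r(2)] by auto
qed simp

text \<open>The factor 2 in \<open>dic_adj\<close> weakens a congruence modulo 2^(k+1) to one modulo
  2^k, which holds throughout the subtree of the root.\<close>

lemma tree_root_adj:
  assumes "Suc k < l" "[i = j] (mod 2 ^ k)"
  shows "dic_adj (2 ^ Suc k, i) (2 ^ l, j)" "dic_adj (2 ^ l, j) (2 ^ Suc k, i)"
proof -
  have "(2 :: nat) ^ Suc k dvd 2 ^ l" using assms(1) by (intro le_imp_power_dvd) simp
  moreover have "(2 :: int) ^ k dvd int i - int j"
    using assms(2) by (simp add: cong_iff_dvd_diff flip: cong_int_iff)
  then have "2 * 2 ^ k dvd 2 * (int i - int j)" by (intro mult_dvd_mono dvd_refl)
  then have "int (2 ^ Suc k) dvd 2 * (int i - int j)"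
    by (simp only: of_nat_power power_Suc of_nat_mult of_nat_numeral)
  moreover have "(2 ^ Suc k :: nat, i) \<noteq> (2 ^ l, j)" using assms(1) by (simp del: power_Suc)
  ultimately show "dic_adj (2 ^ Suc k, i) (2 ^ l, j)" "dic_adj (2 ^ l, j) (2 ^ Suc k, i)"
    by (blast intro: dic_adj_dvdI)+
qed

text \<open>Everything in the left subtree is adjacent to the first root member and everything in
  the right one to the second, so it does not matter where the subpaths begin and end.\<close>

lemma successively_tree_path: "r < 2 ^ k \<Longrightarrow> successively dic_adj (tree_path m k r)"
proof (induction m arbitrary: k r)
  case (Suc m)
  have r: "r < 2 ^ Suc k" "r + 2 ^ k < 2 ^ Suc k" using Suc.prems by simp_all
  have cong: "[i = j] (mod 2 ^ k)" if "i mod 2 ^ k = r" "j mod 2 ^ k = r" for i j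
    using that by (simp add: cong_def)
  have mod_r: "r mod 2 ^ k = r" "(r + 2 ^ k) mod 2 ^ k = r" using Suc.prems by simp_all
  have desc: "\<exists>l j. x = (2 ^ l, j) \<and> Suc k < l \<and> j mod 2 ^ k = r"
    if "x \<in> set (tree_path m (Suc k) r) \<union> set (tree_path m (Suc k) (r + 2 ^ k))" for x
    using that mod_double_iff[OF Suc.prems]
    unfolding Un_iff set_tree_path[OF r(1)] set_tree_path[OF r(2)] by auto
  have left: "dic_adj x (2 ^ Suc k, r)" if "x \<in> set (tree_path m (Suc k) r)" for x
    using desc[of x] that tree_root_adj(2)[OF _ cong[OF mod_r(1)]] by blast
  have right: "dic_adj (2 ^ Suc k, r + 2 ^ k) x" if "x \<in> set (tree_path m (Suc k) (r + 2 ^ k))" for x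
    using desc[of x] that tree_root_adj(1)[OF _ cong[OF mod_r(2)]] by blast
  have mid: "dic_adj (2 ^ Suc k, r) (2 ^ Suc k, r + 2 ^ k)"
    by (intro dic_adj_dvdI) simp_all
  have "successively dic_adj (tree_path m (Suc k) r @ [(2 ^ Suc k, r), (2 ^ Suc k, r + 2 ^ k)] @
      tree_path m (Suc k) (r + 2 ^ k))"
    unfolding successively_append_iff
    using Suc.IH[OF r(1)] Suc.IH[OF r(2)] left[OF last_in_set] right[OF hd_in_set] mid
    by (auto simp del: power_Suc)
  then show ?case by simp
qed simp

lemma dic_index_two_power: "dic_index (2 ^ m) = set (tree_path m 0 0)"
proof -
  have "d dvd 2 ^ m \<and> d \<noteq> 1 \<longleftrightarrow> (\<exists>l. 0 < l \<and> l \<le> m \<and> d = 2 ^ l)" for d :: nat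
    unfolding divides_primepow_nat[OF two_is_prime_nat] by (metis gr0I power_0 nat_power_eq_Suc_0_iff
        One_nat_def numeral_2_eq_2 nat.inject zero_neq_one neq0_conv less_irrefl_nat power_eq_1_iff)
  note iff = this
  have "dic_index (2 ^ m) = {(d, i). (d dvd 2 ^ m \<and> d \<noteq> 1) \<and> i < d}"
    by (simp add: dic_index_def)
  also have "\<dots> = {(2 ^ l, j) | l j. 0 < l \<and> l \<le> m \<and> j < 2 ^ l}"
    unfolding iff by auto
  finally show ?thesis unfolding set_tree_path[of 0 0, simplified] .
qed

section \<open>Explicit path covers, checked by evaluation\<close>

definition dic_list :: "nat \<Rightarrow> (nat \<times> nat) list" where
  "dic_list n = concat (map (\<lambda>d. map (Pair d) [0..<d]) (filter (\<lambda>d. d dvd n) [2..<Suc n]))"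

definition cyc_list :: "nat \<Rightarrow> nat list" where
  "cyc_list n = filter (\<lambda>d. d dvd 2 * n) [1..<2 * n]"

lemma set_dic_list:
  assumes "n > 0"
  shows "set (dic_list n) = dic_index n"
proof -
  have "2 \<le> d \<and> d < Suc n \<longleftrightarrow> d \<noteq> 1" if "d dvd n" for d
    using that assms dvd_imp_le[of d n] dvd_pos_nat[of n d] by linarith
  moreover have "(d, i) \<in> set (dic_list n) \<longleftrightarrow> (2 \<le> d \<and> d < Suc n) \<and> d dvd n \<and> i < d" for d i
    by (auto simp: dic_list_def simp del: upt_Suc)
  ultimately show ?thesis unfolding dic_index_def by blast
qed

lemma set_cyc_list:
  assumes "n > 0"
  shows "set (cyc_list n) = cyc_index n"
proof -
  have "1 \<le> d \<and> d < 2 * n \<longleftrightarrow> d \<noteq> 2 * n" if "d dvd 2 * n" for d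
    using that assms dvd_imp_le[of d "2 * n"] dvd_pos_nat[of "2 * n" d] by linarith
  then show ?thesis by (auto simp: cyc_list_def cyc_index_def)
qed

text \<open>An executable form of the hypotheses of
  \<open>hamiltonian_Dic_path_cover\<close>.\<close>

definition path_cover :: "nat \<Rightarrow> (nat \<times> nat) list list \<Rightarrow> bool" where
  "path_cover n ps \<longleftrightarrow> set (concat ps) = set (dic_list n) \<and> distinct (concat ps) \<and>
    list_all (successively dic_adj) ps \<and> length ps \<le> length (cyc_list n) \<and> 2 \<le> length (concat ps)"

lemma hamiltonian_path_coverI:
  assumes "n > 0" "path_cover n ps"
  shows "hamiltonian (subgroup_graph (Q_group n))"
proof (rule dicyclic.hamiltonian_Dic_path_cover[OF dicyclic_Q_group[OF assms(1)]])
  note pc = assms(2)[unfolded path_cover_def]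
  show "set (concat ps) = dic_index n" "distinct (concat ps)"
    using pc set_dic_list[OF assms(1)] by simp_all
  then show "2 \<le> card (dic_index n)"
    using pc distinct_card[of "concat ps"] by simp
  show "\<forall>p\<in>set ps. successively dic_adj p" using pc by (simp add: list_all_iff)
  have "distinct (cyc_list n)" by (simp add: cyc_list_def)
  then show "length ps \<le> card (cyc_index n)"
    using pc distinct_card[of "cyc_list n"] set_cyc_list[OF assms(1)] by simp
qed

text \<open>The three isolated vertices are linked by exactly three cyclic subgroups, d = 1, 2,
  3.\<close>

lemma hamiltonian_Q_3: "hamiltonian (subgroup_graph (Q_group 3))"
proof (rule hamiltonian_path_coverI)
  show "path_cover 3 [[(3, 0)], [(3, 1)], [(3, 2)]]" by code_simp
qed simp

text \<open>For n = 2q with q odd, \<open>(q, i)\<close>, \<open>(2q, i)\<close> and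
  \<open>(2q, i + q)\<close> form a triangle for each i < q, and \<open>(2, 0)\<close> and
  \<open>(2, 1)\<close> are adjacent to all other dicyclic vertices. The five cyclic subgroups can
  link up to five paths, so for q = 3 and q = 5 each triangle may have a path of its own.\<close>

lemma hamiltonian_Q_6: "hamiltonian (subgroup_graph (Q_group 6))"
proof (rule hamiltonian_path_coverI)
  show "path_cover 6 [[(3, 0), (6, 0), (6, 3), (2, 0)], [(3, 1), (6, 1), (6, 4), (2, 1)],
      [(3, 2), (6, 2), (6, 5)]]"
    by code_simp
qed simp

lemma hamiltonian_Q_10: "hamiltonian (subgroup_graph (Q_group 10))"
proof (rule hamiltonian_path_coverI)
  show "path_cover 10 [[(5, 0), (10, 0), (10, 5), (2, 0)], [(5, 1), (10, 1), (10, 6), (2, 1)],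
      [(5, 2), (10, 2), (10, 7)], [(5, 3), (10, 3), (10, 8)], [(5, 4), (10, 4), (10, 9)]]"
    by code_simp
qed simp

text \<open>Seven triangles exceed the five cyclic subgroups by two, so \<open>(2, 0)\<close> and
  \<open>(2, 1)\<close> are spent on joining three triangles into one path.\<close>

lemma hamiltonian_Q_14: "hamiltonian (subgroup_graph (Q_group 14))"
proof (rule hamiltonian_path_coverI)
  show "path_cover 14 [[(7, 0), (14, 0), (14, 7), (2, 0), (7, 1), (14, 1), (14, 8), (2, 1),
        (7, 2), (14, 2), (14, 9)], [(7, 3), (14, 3), (14, 10)], [(7, 4), (14, 4), (14, 11)],
      [(7, 5), (14, 5), (14, 12)], [(7, 6), (14, 6), (14, 13)]]"
    by code_simp
qed simp

text \<open>The subgroups \<open>(15, i)\<close> are the edges of the complete bipartite graph between the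
  \<open>(3, x)\<close> and the \<open>(5, y)\<close>, so trails in that graph give paths.\<close>

lemma hamiltonian_Q_15: "hamiltonian (subgroup_graph (Q_group 15))"
proof (rule hamiltonian_path_coverI)
  \<comment> \<open>Each of the eight \<open>(3, x)\<close> and \<open>(5, y)\<close> joins two of
    the fifteen \<open>(15, i)\<close>, which leaves 15 - 8 = 7 paths, as many as there are cyclic
    subgroups.\<close>
  show "path_cover 15
    [[(15, 10), (5, 0), (15, 0), (3, 0), (15, 6), (5, 1), (15, 1), (3, 1), (15, 7), (5, 2), (15, 2),
        (3, 2), (15, 8), (5, 3), (15, 13)],
      [(15, 9), (5, 4), (15, 4)], [(15, 3)], [(15, 5)], [(15, 11)], [(15, 12)], [(15, 14)]]"
    by code_simp
qed simp

text \<open>The traversal of the whole tree is a single path, so one cyclic subgroup is enough to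
  close it.\<close>

lemma hamiltonian_Q_two_power:
  assumes "m \<ge> 1"
  shows "hamiltonian (subgroup_graph (Q_group (2 ^ m)))"
proof -
  interpret dicyclic "Q_group (2 ^ m)" "2 ^ m" "Q_pow_a (2 ^ m)" "Q_pow_a_b (2 ^ m)"
    by (rule dicyclic_Q_group) simp
  show ?thesis
  proof (rule hamiltonian_Dic_path_cover[of "[tree_path m 0 0]"])
    show "set (concat [tree_path m 0 0]) = dic_index (2 ^ m)" by (simp add: dic_index_two_power)
    show "distinct (concat [tree_path m 0 0])" by (simp add: distinct_tree_path)
    show "\<forall>p\<in>set [tree_path m 0 0]. successively dic_adj p" by (simp add: successively_tree_path)
    have "1 \<in> cyc_index (2 ^ m)" by (simp add: cyc_index_def)
    then have "card (cyc_index (2 ^ m)) > 0" using finite_cyc_index by (auto simp: card_gt_0_iff)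
    then show "length [tree_path m 0 0] \<le> card (cyc_index (2 ^ m))" by simp
    have "{(2, 0), (2, 1)} \<subseteq> dic_index (2 ^ m)" using assms by (auto simp: dic_index_def)
    from card_mono[OF finite_dic_index this] show "2 \<le> card (dic_index (2 ^ m))" by simp
  qed
qed

section \<open>Counting removed vertices in the negative cases\<close>

lemma card_cyc_index_le:
  assumes "n > 0" "{d. d dvd 2 * n} \<subseteq> A" "finite A"
  shows "card (cyc_index n) < card A"
proof -
  have "cyc_index n \<subseteq> A - {2 * n}" using assms(2) by (auto simp: cyc_index_def)
  then have "card (cyc_index n) \<le> card (A - {2 * n})" using assms(3) by (intro card_mono) auto
  \<comment> \<open>This divisor belongs to the trivial subgroup and makes the bound strict.\<close>
  moreover have "2 * n \<in> A" using assms(2) by auto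
  ultimately show ?thesis using assms(3) by (metis card_Diff1_less order_le_less_trans)
qed

lemma divisors_double: "{d. d dvd 2 * n} \<subseteq> {d. d dvd n} \<union> (*) 2 ` {d. d dvd (n :: nat)}"
proof
  fix d assume "d \<in> {d. d dvd 2 * n}"
  then obtain b c where bc: "d = b * c" "b dvd 2" "c dvd n" using division_decomp by blast
  then have "b = 1 \<or> b = 2" using two_is_prime_nat prime_nat_iff by blast
  then show "d \<in> {d. d dvd n} \<union> (*) 2 ` {d. d dvd n}" using bc by auto
qed

text \<open>Sharp for odd \<open>n\<close>. For even \<open>n\<close> the two sets of divisors
  overlap, so the case 2q lists the divisors of 4q instead.\<close>

lemma card_cyc_index_less:
  assumes "n > 0"
  shows "card (cyc_index n) < 2 * card {d. d dvd n}"
proof -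
  have fin: "finite {d. d dvd n}" using assms by simp
  have "card (cyc_index n) < card ({d. d dvd n} \<union> (*) 2 ` {d. d dvd n})"
    using fin by (intro card_cyc_index_le assms divisors_double) simp
  also have "\<dots> \<le> card {d. d dvd n} + card ((*) 2 ` {d. d dvd n})" by (rule card_Un_le)
  also have "\<dots> \<le> 2 * card {d. d dvd n}" using card_image_le[OF fin, of "(*) 2"] by simp
  finally show ?thesis .
qed

lemma odd_dvd_double_imp_cong:
  assumes "odd n" "int n dvd 2 * (int i - int j)"
  shows "[i = j] (mod n)"
proof -
  have "coprime (int n) 2" using assms(1) by simp
  then have "int n dvd int i - int j"
    using coprime_dvd_mult_right_iff[of "int n" 2 "int i - int j"] assms(2) by blast
  then show ?thesis by (simp add: cong_iff_dvd_diff flip: cong_int_iff)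
qed

text \<open>Modulo an odd \<open>n\<close> the factor 2 in \<open>dic_adj\<close> cancels, so no two
  of the \<open>(n, i)\<close> permute and \<open>snd\<close> gives each its own colour.\<close>

lemma not_hamiltonian_odd:
  assumes n: "n > 1" "odd n" and card: "card (cyc_index n) + card (dic_index n - {n} \<times> {..<n}) < n"
  shows "\<not> hamiltonian (subgroup_graph (Q_group n))"
proof (rule dicyclic.not_hamiltonian_colours[OF dicyclic_Q_group, of n "{n} \<times> {..<n}" snd])
  show "n > 0" using n by simp
  show "{n} \<times> {..<n} \<subseteq> dic_index n" using n by (auto simp: dic_index_def)
  show "snd x = snd y" if "x \<in> {n} \<times> {..<n}" "y \<in> {n} \<times> {..<n}" "dic_adj x y" for x y
  proof -
    from that obtain i j where xy: "x = (n, i)" "y = (n, j)" "i < n" "j < n" by auto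
    have "int (gcd n n) dvd 2 * (int i - int j)"
      using that(3) unfolding dic_adj_def xy fst_conv snd_conv by (rule conjunct2)
    then have "[i = j] (mod n)" using odd_dvd_double_imp_cong[OF n(2)] by (simp only: gcd_idem_nat)
    then show ?thesis using xy by (simp add: cong_less_modulus_unique_nat)
  qed
  have "snd ` ({n} \<times> {..<n}) = {..<n}" using n by simp
  then show "card (cyc_index n) + card (dic_index n - {n} \<times> {..<n}) < card (snd ` ({n} \<times> {..<n}))"
    using card by simp
qed

text \<open>The left side counts the removed vertices for n = p^m: 2m + 1 cyclic subgroups, and p^k
  dicyclic ones for each k with 1 <= k < m.\<close>

lemma sum_powers_less:
  fixes p m :: nat
  assumes "p \<ge> 3" "m \<ge> 1" "p > 3 \<or> m > 1"
  shows "2 * m + 1 + (\<Sum>k\<in>{1..<m}. p ^ k) < p ^ m"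
  using assms(2,3)
proof (induction m rule: nat_induct_at_least)
  case base
  then show ?case by simp
next
  case (Suc m)
  show ?case
  proof (cases "p > 3 \<or> m > 1")
    case True
    have "p ^ m \<ge> p ^ 1" using assms(1) Suc.hyps by (intro power_increasing) auto
    then have "3 \<le> p ^ m" using assms(1) by simp
    moreover have "3 * p ^ m \<le> p ^ Suc m" using assms(1) by simp
    moreover have "(\<Sum>k\<in>{1..<Suc m}. p ^ k) = (\<Sum>k\<in>{1..<m}. p ^ k) + p ^ m"
      using Suc.hyps by simp
    moreover have "2 * Suc m + 1 + S' < R"
      if "3 \<le> P" "3 * P \<le> R" "S' = S + P" "2 * m + 1 + S < P" for P R S S' :: nat
      using that by simp
    ultimately show ?thesis using Suc.IH[OF True] by blast
  next
    case False
    \<comment> \<open>No induction hypothesis is available, since for 3^1 both sides are 3. For 3^2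
      the claim is 8 < 9.\<close>
    then have "p = 3" "m = 1" using assms(1) Suc.hyps by auto
    then show ?thesis by (simp add: eval_nat_numeral)
  qed
qed

lemma not_hamiltonian_Q_odd_prime_power:
  assumes "prime p" "p \<noteq> 2" "m \<ge> 1" "p \<noteq> 3 \<or> m \<noteq> 1"
  shows "\<not> hamiltonian (subgroup_graph (Q_group (p ^ m)))"
proof (rule not_hamiltonian_odd)
  have p: "p \<ge> 3" "odd p"
    using assms(1,2) prime_ge_2_nat[of p] prime_odd_nat[of p] by auto
  show "p ^ m > 1" "odd (p ^ m)" using p assms(3) one_less_power[of p m] by simp_all
  have "{d. d dvd p ^ m} = (\<lambda>k. p ^ k) ` {..m}"
    using divides_primepow_nat[OF assms(1)] by auto
  then have "card {d. d dvd p ^ m} \<le> m + 1" using card_image_le[of "{..m}" "\<lambda>k. p ^ k"] by simp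
  then have cyc: "card (cyc_index (p ^ m)) \<le> 2 * m + 1"
    using card_cyc_index_less[of "p ^ m"] p by simp
  have "dic_index (p ^ m) - {p ^ m} \<times> {..<p ^ m} \<subseteq> (\<Union>k\<in>{1..<m}. {p ^ k} \<times> {..<p ^ k})"
  proof
    fix x assume x: "x \<in> dic_index (p ^ m) - {p ^ m} \<times> {..<p ^ m}"
    then obtain d i where di: "x = (d, i)" "d dvd p ^ m" "d \<noteq> 1" "i < d" "d \<noteq> p ^ m"
      by (auto simp: dic_index_def)
    then obtain k where k: "k \<le> m" "d = p ^ k" using divides_primepow_nat[OF assms(1)] by blast
    then have "k \<noteq> 0" "k \<noteq> m" using di by (auto intro: ccontr)
    then show "x \<in> (\<Union>k\<in>{1..<m}. {p ^ k} \<times> {..<p ^ k})" using k di by auto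
  qed
  then have "card (dic_index (p ^ m) - {p ^ m} \<times> {..<p ^ m}) \<le> card (\<Union>k\<in>{1..<m}. {p ^ k} \<times> {..<p ^ k})"
    by (intro card_mono) auto
  also have "\<dots> \<le> (\<Sum>k\<in>{1..<m}. card ({p ^ k} \<times> {..<p ^ k}))" by (rule card_UN_le) simp
  also have "\<dots> = (\<Sum>k\<in>{1..<m}. p ^ k)" by simp
  finally show "card (cyc_index (p ^ m)) + card (dic_index (p ^ m) - {p ^ m} \<times> {..<p ^ m}) < p ^ m"
    using cyc sum_powers_less[of p m] p assms(3,4) by linarith
qed

lemma divisors_prime_prod:
  assumes "prime (p :: nat)" "prime q"
  shows "{d. d dvd p * q} \<subseteq> {1, p, q, p * q}"
proof
  fix d assume "d \<in> {d. d dvd p * q}"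
  then obtain b c where bc: "d = b * c" "b dvd p" "c dvd q" using division_decomp by blast
  then have "b = 1 \<or> b = p" "c = 1 \<or> c = q" using assms by (auto simp: prime_nat_iff)
  then show "d \<in> {1, p, q, p * q}" using bc by auto
qed

lemma dic_index_prime_prod_subset:
  assumes "prime p" "prime q"
  shows "dic_index (p * q) \<subseteq> {p} \<times> {..<p} \<union> {q} \<times> {..<q} \<union> {p * q} \<times> {..<p * q}"
  using divisors_prime_prod[OF assms] by (auto simp: dic_index_def)

lemma not_hamiltonian_Q_odd_prime_prod:
  assumes "prime p" "prime q" "2 < p" "p < q" "\<not> (p = 3 \<and> q = 5)"
  shows "\<not> hamiltonian (subgroup_graph (Q_group (p * q)))"
proof (rule not_hamiltonian_odd)
  have odd: "odd p" "odd q" using assms prime_odd_nat[of p] prime_odd_nat[of q] by auto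
  have "p * q > 1 * 1" using assms by (intro mult_strict_mono) auto
  then show "p * q > 1" by simp
  show "odd (p * q)" using odd by simp
  have "card {d. d dvd p * q} \<le> card {1, p, q, p * q}"
    by (intro card_mono divisors_prime_prod assms) simp
  also have "\<dots> \<le> 4" by (simp add: card_insert_if)
  finally have cyc: "card (cyc_index (p * q)) < 8"
    using card_cyc_index_less[of "p * q"] assms by simp
  have "dic_index (p * q) - {p * q} \<times> {..<p * q} \<subseteq> {p} \<times> {..<p} \<union> {q} \<times> {..<q}"
    using dic_index_prime_prod_subset[OF assms(1,2)] by blast
  then have "card (dic_index (p * q) - {p * q} \<times> {..<p * q}) \<le> card ({p} \<times> {..<p} \<union> {q} \<times> {..<q})"
    by (intro card_mono) auto
  also have "\<dots> \<le> p + q" using card_Un_le[of "{p} \<times> {..<p}" "{q} \<times> {..<q}"] by simp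
  finally have dic: "card (dic_index (p * q) - {p * q} \<times> {..<p * q}) \<le> p + q" .
  \<comment> \<open>Equivalent to (p - 1)(q - 1) > 8. For p = 3 this means q > 5; for p >= 5 the
    product is at least 4 * 6.\<close>
  have "7 + p + q < p * q"
  proof (cases "p = 3")
    case True
    then show ?thesis using assms odd by presburger
  next
    case False
    then have "p \<ge> 5" "q \<ge> 7" using assms odd by presburger+
    then have "(p - 1) * (q - 1) \<ge> 4 * 6" by (intro mult_mono) auto
    moreover have "(p - 1) * (q - 1) + p + q = p * q + 1"
      using \<open>p \<ge> 5\<close> \<open>q \<ge> 7\<close> by (cases p; cases q) auto
    ultimately show ?thesis by linarith
  qed
  then show "card (cyc_index (p * q)) + card (dic_index (p * q) - {p * q} \<times> {..<p * q}) < p * q"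
    using cyc dic by linarith
qed

text \<open>Removing the \<open>5\<close> cyclic subgroups and the two subgroups \<open>(2, i)\<close> leaves \<open>q\<close> triangles.\<close>

lemma not_hamiltonian_Q_twice_prime:
  assumes "prime q" "7 < q"
  shows "\<not> hamiltonian (subgroup_graph (Q_group (2 * q)))"
proof (rule dicyclic.not_hamiltonian_colours[OF dicyclic_Q_group, of "2 * q"
      "{q} \<times> {..<q} \<union> {2 * q} \<times> {..<2 * q}" "\<lambda>x. snd x mod q"])
  let ?L = "{q} \<times> {..<q} \<union> {2 * q} \<times> {..<2 * q}"
  have odd: "odd q" using assms prime_odd_nat[of q] by auto
  show "2 * q > 0" using assms by simp
  show "?L \<subseteq> dic_index (2 * q)" using assms by (auto simp: dic_index_def)
  \<comment> \<open>The residue modulo \<open>q\<close> names the triangle: all first components in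
    \<open>?L\<close> are multiples of the odd number \<open>q\<close>, so adjacency preserves
    it.\<close>
  show "snd x mod q = snd y mod q" if "x \<in> ?L" "y \<in> ?L" "dic_adj x y" for x y
  proof -
    have "q dvd gcd (fst x) (fst y)" using that by auto
    then have "int q dvd 2 * (int (snd x) - int (snd y))"
      using that(3) unfolding dic_adj_def by (meson dvd_trans int_dvd_int_iff)
    then have "[snd x = snd y] (mod q)" by (rule odd_dvd_double_imp_cong[OF odd])
    then show ?thesis by (simp add: cong_def)
  qed
  \<comment> \<open>Six divisors, of which 4q gives the trivial subgroup; five cyclic vertices and
    the two \<open>(2, i)\<close> make seven, fewer than \<open>q\<close>.\<close>
  have "{d. d dvd 2 * (2 * q)} \<subseteq> {1, 2, q, 2 * q, 4, 4 * q}"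
    using divisors_double[of "2 * q"] divisors_prime_prod[OF two_is_prime_nat assms(1)] by fastforce
  then have "card (cyc_index (2 * q)) < card {1, 2, q, 2 * q, 4, 4 * q}"
    using assms by (intro card_cyc_index_le) auto
  also have "\<dots> \<le> 6" by (simp add: card_insert_if)
  finally have cyc: "card (cyc_index (2 * q)) < 6" .
  have "dic_index (2 * q) - ?L \<subseteq> {2} \<times> {..<2}"
    using dic_index_prime_prod_subset[OF two_is_prime_nat assms(1)] by blast
  then have "card (dic_index (2 * q) - ?L) \<le> card ({2 :: nat} \<times> {..<2 :: nat})" by (intro card_mono) auto
  then have dic: "card (dic_index (2 * q) - ?L) \<le> 2" by simp
  have "(\<lambda>x. snd x mod q) ` ?L = {..<q}"
  proof
    show "(\<lambda>x. snd x mod q) ` ?L \<subseteq> {..<q}" using assms by auto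
    show "{..<q} \<subseteq> (\<lambda>x. snd x mod q) ` ?L"
    proof
      fix i assume "i \<in> {..<q}"
      then have "i = snd (q, i) mod q" "(q, i) \<in> ?L" by auto
      then show "i \<in> (\<lambda>x. snd x mod q) ` ?L" by (rule image_eqI)
    qed
  qed
  then have "card ((\<lambda>x. snd x mod q) ` ?L) = q" by simp
  then show "card (cyc_index (2 * q)) + card (dic_index (2 * q) - ?L) < card ((\<lambda>x. snd x mod q) ` ?L)"
    using cyc dic assms(2) by linarith
qed

theorem theorem5p5:
  fixes n :: nat
  assumes "n > 1"
  shows "(\<forall>(p::nat) (\<alpha>::nat). prime p \<and> \<alpha> \<ge> 1 \<and> n = p ^ \<alpha> \<longrightarrow>
            (hamiltonian (subgroup_graph (Q_group n)) \<longleftrightarrow> p = 2 \<or> p = 3 \<and> \<alpha> = 1))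
       \<and> (\<forall>(p::nat) (q::nat). prime p \<and> prime q \<and> p < q \<and> n = p * q \<longrightarrow>
            (hamiltonian (subgroup_graph (Q_group n)) \<longleftrightarrow> p = 2 \<and> q \<le> 7 \<or> p = 3 \<and> q = 5))"
proof (intro conjI allI impI)
  fix p \<alpha> :: nat assume *: "prime p \<and> \<alpha> \<ge> 1 \<and> n = p ^ \<alpha>"
  show "hamiltonian (subgroup_graph (Q_group n)) \<longleftrightarrow> p = 2 \<or> p = 3 \<and> \<alpha> = 1"
    using * hamiltonian_Q_two_power[of \<alpha>] hamiltonian_Q_3
      not_hamiltonian_Q_odd_prime_power[of p \<alpha>] by auto
next
  fix p q :: nat assume *: "prime p \<and> prime q \<and> p < q \<and> n = p * q"
  then have p: "p = 2 \<or> p > 2" using prime_ge_2_nat[of p] by auto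
  \<comment> \<open>Reduces the positive half for p = 2 to the explicit covers for n = 6, 10 and
    14.\<close>
  have "q = 3 \<or> q = 5 \<or> q = 7" if "p = 2" "q \<le> 7"
  proof -
    have "odd q" "2 < q" using * that prime_odd_nat[of q] by auto
    then show ?thesis using that(2) by presburger
  qed
  then show "hamiltonian (subgroup_graph (Q_group n)) \<longleftrightarrow> p = 2 \<and> q \<le> 7 \<or> p = 3 \<and> q = 5"
    using * p hamiltonian_Q_6 hamiltonian_Q_10 hamiltonian_Q_14 hamiltonian_Q_15
      not_hamiltonian_Q_odd_prime_prod[of p q] not_hamiltonian_Q_twice_prime[of q]
    by (cases "p = 2"; cases "q \<le> 7") auto
qed

end
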